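(* Let $n\geq3$ be odd, let $\sigma$ be the right congruence on the Brauer monoid $\mathcal B_n$ defined in the context, let $\Omega=\{[\alpha]_\sigma:\alpha\in\mathcal B_n,\ \operatorname{rank}(\alpha)\leq3\}$, and let $\mu:\Omega\times\mathcal B_n\to\Omega$ be the action $\mu([\alpha]_\sigma,\beta)=[\alpha\beta]_\sigma$. Then $\mu$ is faithful and monogenic, and consequently $$\deg(\mathcal B_n)\leq\deg_{\mathrm{rc}}(\mathcal B_n)\leq1+3p_3+p_1,$$ where $p_r$ is the number of projections of $\mathcal B_n$ of rank $r$.
   Context: Brauer monoid. For an integer $n\ge 0$ let $\mathbf n=\{1,\dots,n\}$ and $\mathbf n'=\{1',\dots,n'\}$. $\mathcal B_n$ is the set of all set partitions of $\mathbf n\cup\mathbf n'$ into blocks of size exactly $2$. Product of $\alpha,\beta$: with $\mathbf n''=\{1'',\dots,n''\}$, rename each $x'$ in $\alpha$ as $x''$ and each (unprimed) $x$ in $\beta$ as $x''$; consider the equivalence on $\mathbf n\cup\mathbf n''\cup\mathbf n'$ generated by the blocks of these two renamed partitions; $x,y\in\mathbf n\cup\mathbf n'$ are in the same block of $\alpha\beta$ iff they are related by this equivalence. This is a monoid with identity the partition with blocks $\{x,x'\}$. $\alpha^*$ is obtained from $\alpha$ by interchanging $x$ and $x'$ for all $x$. $\operatorname{rank}(\alpha)$ is the number of blocks of $\alpha$ meeting both $\mathbf n$ and $\mathbf n'$. $\ker(\alpha)=\{(x,y)\in\mathbf n\times\mathbf n: x,y\text{ lie in the same block of }\alpha\}$.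 The symmetric group $\mathcal S_n$ is identified with the group of units of $\mathcal B_n$, i.e. the elements of rank $n$. A projection is an element $\varepsilon$ with $\varepsilon^2=\varepsilon=\varepsilon^*$. The right congruence $\sigma$ ($n$ odd). Let $\zeta\in\mathcal B_n$ be the element with blocks $\{1,1'\}$, and $\{2i,2i+1\}$ and $\{(2i)',(2i+1)'\}$ for $1\le i\le (n-1)/2$. Let $\kappa=\ker(\zeta)$, let $K=\{\alpha\in\mathcal B_n:\ker(\alpha)\subseteq\kappa\}$, let $I=\mathcal B_n\setminus K$ (a right ideal), and let $U=\{\alpha\in\mathcal S_n:\alpha\zeta=\zeta\}$. Then $\sigma=\{(\alpha,\beta)\in\mathcal B_n\times\mathcal B_n:\ \alpha,\beta\in I,\text{ or }[\alpha,\beta\in K\text{ and }U\alpha=U\beta]\}$, which is a right congruence (an equivalence with $(\alpha,\beta)\in\sigma\Rightarrow(\alpha\theta,\beta\theta)\in\sigma$). $[\alpha]_\sigma$ denotes the $\sigma$-class of $\alpha$. Actions and degrees. A right action of a semigroup $S$ on $X$ is a map $\mu:X\times S\to X$ with $\mu(\mu(x,a),b)=\mu(x,ab)$. It is faithful if distinct elements of $S$ induce distinct maps $X\to X$. It is monogenic if for some $x\in X$ we have $X=\{x\}\cup\{\mu(x,a):a\in S\}$. For a finite semigroup $S$, $\deg(S)$ is the least $m\geq1$ such that $S$ embeds (via an injective semigroup homomorphism) in the monoid $\mathcal T_m$ of all self-maps of $\{1,\dots,m\}$ composed left to right. $\deg_{\mathrm{rc}}(S)$ is the minimum of $|S/\tau|$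 over right congruences $\tau$ on $S$ for which the action of $S$ on $S/\tau$ given by $([x]_\tau,a)\mapsto[xa]_\tau$ is faithful. *)

theory Defs
  imports "HOL-Library.Disjoint_Sets" "HOL-Library.FuncSet" "HOL-Algebra.Coset"
begin

section \<open>Semigroups, right actions and degrees\<close>

text \<open>
  A semigroup is given by the fields \<open>carrier\<close> and \<open>mult\<close> of a HOL-Algebra \<open>monoid\<close> record; the
  field \<open>one\<close> plays no role in this section. In particular \<open>hom\<close> and \<open>mon\<close> only demand
  compatibility with multiplication, so \<open>mon S T\<close> is the set of injective semigroup homomorphisms.
\<close>

definition full_transformation_monoid :: "nat \<Rightarrow> (nat \<Rightarrow> nat) monoid" where
  "full_transformation_monoid m =
     \<lparr>carrier = {1..m} \<rightarrow>\<^sub>E {1..m},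
      mult = (\<lambda>f g. \<lambda>x\<in>{1..m}. g (f x)),
      one = (\<lambda>x\<in>{1..m}. x)\<rparr>"

definition right_action :: "('a, 'c) monoid_scheme \<Rightarrow> 'x set \<Rightarrow> ('x \<Rightarrow> 'a \<Rightarrow> 'x) \<Rightarrow> bool" where
  "right_action S X \<mu> \<longleftrightarrow>
     (\<forall>x\<in>X. \<forall>a\<in>carrier S. \<mu> x a \<in> X) \<and>
     (\<forall>x\<in>X. \<forall>a\<in>carrier S. \<forall>b\<in>carrier S. \<mu> (\<mu> x a) b = \<mu> x (a \<otimes>\<^bsub>S\<^esub> b))"

definition faithful_action :: "('a, 'c) monoid_scheme \<Rightarrow> 'x set \<Rightarrow> ('x \<Rightarrow> 'a \<Rightarrow> 'x) \<Rightarrow> bool" where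
  "faithful_action S X \<mu> \<longleftrightarrow>
     (\<forall>a\<in>carrier S. \<forall>b\<in>carrier S. a \<noteq> b \<longrightarrow> (\<exists>x\<in>X. \<mu> x a \<noteq> \<mu> x b))"

definition monogenic_action :: "('a, 'c) monoid_scheme \<Rightarrow> 'x set \<Rightarrow> ('x \<Rightarrow> 'a \<Rightarrow> 'x) \<Rightarrow> bool" where
  "monogenic_action S X \<mu> \<longleftrightarrow> (\<exists>x\<in>X. X = insert x {\<mu> x a | a. a \<in> carrier S})"

definition right_congruence :: "('a, 'c) monoid_scheme \<Rightarrow> ('a \<times> 'a) set \<Rightarrow> bool" where
  "right_congruence S \<tau> \<longleftrightarrow>
     equiv (carrier S) \<tau> \<and>
     (\<forall>x y. \<forall>a\<in>carrier S. (x, y) \<in> \<tau> \<longrightarrow> (x \<otimes>\<^bsub>S\<^esub> a, y \<otimes>\<^bsub>S\<^esub> a) \<in> \<tau>)"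

text \<open>
  The map sending the class of \<open>x\<close> and the element \<open>a\<close> to the class of \<open>x \<otimes> a\<close>, as the usual union
  over all representatives; see \<open>quot_act_class\<close> for the defining equation.
\<close>

definition quot_act :: "('a, 'c) monoid_scheme \<Rightarrow> ('a \<times> 'a) set \<Rightarrow> 'a set \<Rightarrow> 'a \<Rightarrow> 'a set" where
  "quot_act S \<tau> X a = (\<Union>x\<in>X. \<tau> `` {x \<otimes>\<^bsub>S\<^esub> a})"

lemma quot_act_class:
  assumes "right_congruence S \<tau>" and "x \<in> carrier S" and "a \<in> carrier S"
  shows "quot_act S \<tau> (\<tau> `` {x}) a = \<tau> `` {x \<otimes>\<^bsub>S\<^esub> a}"
proof -
  have eq: "equiv (carrier S) \<tau>"
    using assms(1) by (simp add: right_congruence_def)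
  have "(\<lambda>x. \<tau> `` {x \<otimes>\<^bsub>S\<^esub> a}) respects \<tau>"
  proof (rule congruentI)
    fix y z assume "(y, z) \<in> \<tau>"
    then have "(y \<otimes>\<^bsub>S\<^esub> a, z \<otimes>\<^bsub>S\<^esub> a) \<in> \<tau>"
      using assms(1,3) by (simp add: right_congruence_def)
    then show "\<tau> `` {y \<otimes>\<^bsub>S\<^esub> a} = \<tau> `` {z \<otimes>\<^bsub>S\<^esub> a}"
      by (rule equiv_class_eq [OF eq])
  qed
  then show ?thesis
    unfolding quot_act_def by (rule UN_equiv_class [OF eq _ assms(2)])
qed

text \<open>
  Both degrees are only meaningful for finite semigroups, and \<open>deg_rc\<close> only if some right
  congruence has a faithful quotient action (in a monoid, equality is one).
\<close>

definition deg :: "('a, 'c) monoid_scheme \<Rightarrow> nat" where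
  "deg S = (LEAST m. m \<ge> 1 \<and> mon S (full_transformation_monoid m) \<noteq> {})"

definition deg_rc :: "('a, 'c) monoid_scheme \<Rightarrow> nat" where
  "deg_rc S = (LEAST m. \<exists>\<tau>. right_congruence S \<tau> \<and>
     faithful_action S (carrier S // \<tau>) (quot_act S \<tau>) \<and> m = card (carrier S // \<tau>))"


section \<open>The Brauer monoid\<close>

text \<open>
  \<open>Up x\<close>, \<open>Low x\<close> and \<open>Mid x\<close> stand for $x$, $x'$ and $x''$. The vertices \<open>Mid x\<close> only occur while
  forming products.
\<close>

datatype vertex = Up nat | Mid nat | Low nat

definition vertices :: "nat \<Rightarrow> vertex set" where
  "vertices n = Up ` {1..n} \<union> Low ` {1..n}"

fun low_to_mid :: "vertex \<Rightarrow> vertex" where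
  "low_to_mid (Low x) = Mid x"
| "low_to_mid v = v"

fun up_to_mid :: "vertex \<Rightarrow> vertex" where
  "up_to_mid (Up x) = Mid x"
| "up_to_mid v = v"

text \<open>
  The relation of lying in a common block is symmetric, so its reflexive transitive closure is the
  equivalence generated by the blocks.
\<close>

definition generated_equiv :: "vertex set set \<Rightarrow> (vertex \<times> vertex) set" where
  "generated_equiv P = {(x, y). \<exists>B\<in>P. x \<in> B \<and> y \<in> B}\<^sup>*"

definition brauer_mult :: "nat \<Rightarrow> vertex set set \<Rightarrow> vertex set set \<Rightarrow> vertex set set" where
  "brauer_mult n \<alpha> \<beta> =
     vertices n //
       {(x, y) \<in> vertices n \<times> vertices n.
          (x, y) \<in> generated_equiv ((`) low_to_mid ` \<alpha> \<union> (`) up_to_mid ` \<beta>)}"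

definition brauer :: "nat \<Rightarrow> vertex set set monoid" where
  "brauer n =
     \<lparr>carrier = {\<alpha>. partition_on (vertices n) \<alpha> \<and> (\<forall>B\<in>\<alpha>. card B = 2)},
      mult = brauer_mult n,
      one = {{Up x, Low x} | x. x \<in> {1..n}}\<rparr>"

fun flip :: "vertex \<Rightarrow> vertex" where
  "flip (Up x) = Low x"
| "flip (Low x) = Up x"
| "flip (Mid x) = Mid x"

definition star :: "vertex set set \<Rightarrow> vertex set set" where
  "star \<alpha> = (`) flip ` \<alpha>"

definition rank :: "vertex set set \<Rightarrow> nat" where
  "rank \<alpha> = card {B \<in> \<alpha>. (\<exists>x. Up x \<in> B) \<and> (\<exists>y. Low y \<in> B)}"

definition ker :: "vertex set set \<Rightarrow> (nat \<times> nat) set" where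
  "ker \<alpha> = {(x, y). \<exists>B\<in>\<alpha>. Up x \<in> B \<and> Up y \<in> B}"

definition projections :: "nat \<Rightarrow> vertex set set set" where
  "projections n = {\<epsilon> \<in> carrier (brauer n). \<epsilon> \<otimes>\<^bsub>brauer n\<^esub> \<epsilon> = \<epsilon> \<and> \<epsilon> = star \<epsilon>}"

definition num_projections :: "nat \<Rightarrow> nat \<Rightarrow> nat" where
  "num_projections n r = card {\<epsilon> \<in> projections n. rank \<epsilon> = r}"


section \<open>The right congruence \<open>\<sigma>\<close> and its action\<close>

text \<open>The definitions in this section are intended for odd \<open>n\<close> only.\<close>

definition zeta :: "nat \<Rightarrow> vertex set set" where
  "zeta n = insert {Up 1, Low 1}
     (\<Union>i\<in>{1..(n - 1) div 2}. {{Up (2*i), Up (2*i + 1)}, {Low (2*i), Low (2*i + 1)}})"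

definition K :: "nat \<Rightarrow> vertex set set set" where
  "K n = {\<alpha> \<in> carrier (brauer n). ker \<alpha> \<subseteq> ker (zeta n)}"

definition I :: "nat \<Rightarrow> vertex set set set" where
  "I n = carrier (brauer n) - K n"

definition U :: "nat \<Rightarrow> vertex set set set" where
  "U n = {\<alpha> \<in> Units (brauer n). \<alpha> \<otimes>\<^bsub>brauer n\<^esub> zeta n = zeta n}"

definition sigma :: "nat \<Rightarrow> (vertex set set \<times> vertex set set) set" where
  "sigma n = {(\<alpha>, \<beta>) \<in> carrier (brauer n) \<times> carrier (brauer n).
     (\<alpha> \<in> I n \<and> \<beta> \<in> I n) \<or>
     (\<alpha> \<in> K n \<and> \<beta> \<in> K n \<and> U n #>\<^bsub>brauer n\<^esub> \<alpha> = U n #>\<^bsub>brauer n\<^esub> \<beta>)}"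

definition Omega :: "nat \<Rightarrow> vertex set set set set" where
  "Omega n = {sigma n `` {\<alpha>} | \<alpha>. \<alpha> \<in> carrier (brauer n) \<and> rank \<alpha> \<le> 3}"

definition mu :: "nat \<Rightarrow> vertex set set set \<Rightarrow> vertex set set \<Rightarrow> vertex set set set" where
  "mu n = quot_act (brauer n) (sigma n)"

end

theory Submission
  imports Defs
begin

text \<open>
  If \<open>\<alpha>\<close> and \<open>\<beta>\<close> act equally on \<open>\<Omega>\<close>, diagrams \<open>\<gamma>\<close> of rank at most 3 in \<open>K\<close> whose through lines
  are aimed at chosen points recover first the upper hooks (is \<open>\<gamma>\<alpha>\<close> in \<open>K\<close> or in \<open>I\<close>?), then the
  through lines (elements of \<open>U\<close> fix 1, so the partner of 1 is an invariant of a class in \<open>K\<close>) and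
  the lower hooks (another invariant). The class of the rank 3 projection \<open>\<epsilon>\<close> that differs from
  \<open>\<zeta>\<close> only on 2 and 3 generates \<open>\<Omega>\<close>, because modulo \<open>U\<close> every element of \<open>K\<close> of rank at most 3
  has the form \<open>\<epsilon>\<alpha>\<close>. This normal form also shows that a class in \<open>K\<close> is determined by the two
  invariants. The lower hooks amount to a projection, and if that has rank \<open>r\<close> there are \<open>r\<close>
  choices for the partner of 1.
\<close>

section \<open>Perfect matchings\<close>

text \<open>Products are defined through a generated equivalence, so closure and associativity both
  need an argument. It is the same one: the union of two matchings falls into paths and cycles, so a
  vertex covered by just one of them is connected to exactly one other such vertex. Rank 1 alone
  would not be faithful. An element \<gamma> of \<open>K\<close> of rank 1 already has all hooks of
  \<zeta>, so \<gamma>\<alpha> never leaves \<open>K\<close>; and two \<alpha> of rank 1 with the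
  same lower hooks give the same \<gamma>\<alpha>. The lines at 2 and 3 are what makes the test
  against \<open>I\<close> possible. Dividing by \<open>U\<close> keeps the count low: in rank 3 the
  three lower ends can be attached to 1, 2, 3 in six ways, and exchanging 2 and 3 leaves three
  classes. Ranks are odd because \<open>n\<close> is, so only projections of rank 3 and 1 occur; the
  summand 1 in the bound is the class \<open>I\<close>. A faithful action generated by one point
  \<open>x\<close> is, up to isomorphism, the action on the quotient by the right congruence that
  identifies \<open>a\<close> and \<open>b\<close> when they move \<open>x\<close> to the same
  point. Hence the size of \<Omega> bounds \<open>deg_rc\<close>.\<close>

definition perfect_matching :: "'a set \<Rightarrow> 'a set set \<Rightarrow> bool" where
  "perfect_matching V P \<longleftrightarrow> partition_on V P \<and> (\<forall>B\<in>P. card B = 2)"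

definition linked :: "'a set set \<Rightarrow> ('a \<times> 'a) set" where
  "linked P = {(x, y). \<exists>B\<in>P. x \<in> B \<and> y \<in> B}"

lemma perfect_matching_Union: "perfect_matching V P \<Longrightarrow> \<Union>P = V"
  by (auto simp: perfect_matching_def partition_on_def)

lemma perfect_matching_subset: "perfect_matching V P \<Longrightarrow> B \<in> P \<Longrightarrow> B \<subseteq> V"
  by (auto simp: perfect_matching_def partition_on_def)

lemma perfect_matching_neq: "perfect_matching V P \<Longrightarrow> {x, y} \<in> P \<Longrightarrow> x \<noteq> y"
  by (force simp: perfect_matching_def)

lemma perfect_matching_same_block:
  assumes "perfect_matching V P" "B \<in> P" "x \<in> B" "y \<in> B" "x \<noteq> y"
  shows "B = {x, y}"
proof -
  have "card B = 2" using assms by (simp add: perfect_matching_def)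
  then show ?thesis using assms(3-5) by (auto simp: card_2_iff)
qed

lemma perfect_matching_block:
  assumes "perfect_matching V P" "B \<in> P"
  obtains x y where "B = {x, y}" "x \<noteq> y" "x \<in> V" "y \<in> V"
  using assms perfect_matching_subset[OF assms]
  by (auto simp: perfect_matching_def card_2_iff)

lemma perfect_matching_block_unique:
  assumes "perfect_matching V P" "B \<in> P" "C \<in> P" "x \<in> B" "x \<in> C"
  shows "B = C"
  using assms disjointD[of P B C] by (auto simp: perfect_matching_def partition_on_def)

lemma perfect_matching_partner:
  assumes "perfect_matching V P" "x \<in> V"
  obtains y where "{x, y} \<in> P" "y \<noteq> x" "y \<in> V"
proof -
  obtain B where "B \<in> P" "x \<in> B"
    using assms perfect_matching_Union by blast
  obtain u w where uw: "B = {u, w}" "u \<noteq> w" "u \<in> V" "w \<in> V"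
    using perfect_matching_block[OF assms(1) \<open>B \<in> P\<close>] by metis
  then show thesis
    using that[of w] that[of u] \<open>B \<in> P\<close> \<open>x \<in> B\<close> by (auto simp: insert_commute)
qed

lemma perfect_matching_unique:
  assumes "perfect_matching V P" "{x, y} \<in> P" "{x, z} \<in> P"
  shows "y = z"
proof -
  have "{x, y} = {x, z}"
    using assms by (intro perfect_matching_block_unique[OF assms(1), of _ _ x]) auto
  then show ?thesis by (auto simp: doubleton_eq_iff)
qed

text \<open>Each point has its only \<open>Q\<close>-partner already in \<open>P\<close>, so
  matchings of one set are never strictly nested. Every later equality of diagrams rests on a single
  inclusion.\<close>

lemma perfect_matching_eqI:
  assumes "perfect_matching V P" "perfect_matching V Q" "P \<subseteq> Q"
  shows "P = Q"
proof
  show "Q \<subseteq> P"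
  proof
    fix B assume B: "B \<in> Q"
    then obtain x y where xy: "B = {x, y}" "x \<in> V"
      using perfect_matching_block[OF assms(2)] by metis
    obtain z where z: "{x, z} \<in> P" using perfect_matching_partner[OF assms(1) xy(2)] by metis
    then have "y = z" using perfect_matching_unique[OF assms(2)] assms(3) B xy(1) by blast
    then show "B \<in> P" using z xy(1) by simp
  qed
qed fact

text \<open>Here the ground sets may differ a priori, as they do for the lower hooks of two
  diagrams.\<close>

lemma perfect_matching_ext:
  assumes P: "perfect_matching V P" and Q: "perfect_matching W Q"
    and eq: "\<And>x y. {x, y} \<in> P \<longleftrightarrow> {x, y} \<in> Q"
  shows "P = Q"
proof (intro equalityI subsetI)
  fix B assume B: "B \<in> P"
  then obtain x y where "B = {x, y}" using perfect_matching_block[OF P] by metis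
  then show "B \<in> Q" using B eq by simp
next
  fix B assume B: "B \<in> Q"
  then obtain x y where "B = {x, y}" using perfect_matching_block[OF Q] by metis
  then show "B \<in> P" using B eq by simp
qed

lemma perfect_matching_even:
  assumes "perfect_matching V P" "finite V"
  shows "even (card V)"
proof -
  have p: "partition_on V P" using assms(1) by (simp add: perfect_matching_def)
  have "card V = sum card P" using product_partition[OF p] assms p
    by (auto dest: partition_onD1 finite_subset[rotated])
  also have "\<dots> = 2 * card P" using assms(1) by (simp add: perfect_matching_def)
  finally show ?thesis by simp
qed

lemma perfect_matching_mono:
  assumes "perfect_matching V P" "Q \<subseteq> P"
  shows "perfect_matching (\<Union>Q) Q"
  using assms by (auto simp: perfect_matching_def partition_on_def intro: pairwise_subset)

lemma perfect_matching_Un: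
  assumes "perfect_matching V P" "perfect_matching W Q" "V \<inter> W = {}"
  shows "perfect_matching (V \<union> W) (P \<union> Q)"
  using assms disjoint_union[of P Q] by (auto simp: perfect_matching_def partition_on_def)

lemma perfect_matching_image:
  assumes "perfect_matching V P" "inj_on f V"
  shows "perfect_matching (f ` V) ((`) f ` P)"
proof -
  have "partition_on (f ` V) ((`) f ` P)"
  proof -
    have "(`) f ` P - {{}} = (`) f ` P" using assms(1) by (auto simp: perfect_matching_def partition_on_def)
    then show ?thesis
      using partition_on_inj_image[OF _ assms(2), of P] assms(1) by (simp add: perfect_matching_def)
  qed
  moreover have "card (f ` B) = 2" if "B \<in> P" for B
    using that assms inj_on_subset[OF assms(2) perfect_matching_subset[OF assms(1) that]]
    by (simp add: card_image perfect_matching_def)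
  ultimately show ?thesis by (auto simp: perfect_matching_def)
qed

lemma perfect_matching_exists:
  assumes "finite V" "even (card V)"
  shows "\<exists>P. perfect_matching V P"
  using assms
proof (induction "card V" arbitrary: V rule: less_induct)
  case less
  show ?case
  proof (cases "V = {}")
    case True
    then show ?thesis by (intro exI[of _ "{}"]) (simp add: perfect_matching_def partition_on_def)
  next
    case False
    have "card V \<noteq> 1" using less.prems(2) by auto
    moreover have "card V \<noteq> 0" using False less.prems(1) by simp
    ultimately have "2 \<le> card V" by linarith
    then obtain W where W: "W \<subseteq> V" "card W = 2" by (meson obtain_subset_with_card_n)
    have c: "card (V - W) = card V - 2" using W less.prems(1) by (simp add: card_Diff_subset finite_subset)
    obtain P where P: "perfect_matching (V - W) P"
      using less.hyps[of "V - W"] c \<open>2 \<le> card V\<close> less.prems by auto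
    have "perfect_matching W {W}" using W by (auto simp: perfect_matching_def partition_on_def disjoint_def)
    then have "perfect_matching ((V - W) \<union> W) (P \<union> {W})"
      using P by (intro perfect_matching_Un) auto
    then show ?thesis using W(1) by (metis Un_Diff_cancel2 Un_absorb2)
  qed
qed

lemma perfect_matching_extend:
  assumes "perfect_matching W P" "W \<subseteq> V" "finite V" "even (card V)"
  obtains Q where "perfect_matching V Q" "P \<subseteq> Q"
proof -
  have "even (card (V - W))"
    using assms perfect_matching_even[OF assms(1)] by (simp add: card_Diff_subset finite_subset)
  then obtain Q where "perfect_matching (V - W) Q"
    using perfect_matching_exists assms(3) by blast
  then have "perfect_matching (W \<union> (V - W)) (P \<union> Q)"
    using assms(1) by (intro perfect_matching_Un) auto
  then show thesis using that[of "P \<union> Q"] assms(2) by (simp add: Un_absorb1)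
qed

section \<open>Components of the union of two matchings\<close>

text \<open>
  In \<open>alternation A B\<close> the Boolean says which of the two matchings the walk follows next; this makes
  the walk deterministic, so it has at most one terminal state.
\<close>

definition alternation :: "'a set set \<Rightarrow> 'a set set \<Rightarrow> (('a \<times> bool) \<times> ('a \<times> bool)) set" where
  "alternation A B = {((x, s), (y, t)). t = (\<not> s) \<and> {x, y} \<in> (if s then A else B)}"

lemma single_valued_alternation:
  assumes "perfect_matching V A" "perfect_matching W B"
  shows "single_valued (alternation A B)"
proof (rule single_valuedI)
  fix p q r assume "(p, q) \<in> alternation A B" "(p, r) \<in> alternation A B"
  then show "q = r"
    using perfect_matching_unique[OF assms(1), of "fst p" "fst q" "fst r"]
      perfect_matching_unique[OF assms(2), of "fst p" "fst q" "fst r"]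
    by (auto simp: alternation_def split: if_splits)
qed

text \<open>A path in the union may stall or double back, while the walk has to alternate. A step
  along the matching used last returns to the previous vertex, because partners are unique, so the
  last step of the walk is undone instead. At the very start such a step would need \<open>B\<close>
  at \<open>v\<close>, which \<open>v \<notin> W\<close> excludes.\<close>

lemma linked_alternation:
  assumes A: "perfect_matching V A" and B: "perfect_matching W B" and v: "v \<notin> W"
    and "(v, x) \<in> (linked (A \<union> B))\<^sup>*"
  shows "\<exists>s. ((v, True), (x, s)) \<in> (alternation A B)\<^sup>*"
  using assms(4)
proof (induction rule: rtrancl_induct)
  case base
  then show ?case by blast
next
  case (step y z)
  then obtain s where s: "((v, True), (y, s)) \<in> (alternation A B)\<^sup>*" by blast
  show ?case
  proof (cases "y = z")
    case True
    then show ?thesis using s by blast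
  next
    case False
    obtain X where "X \<in> A \<or> X \<in> B" "y \<in> X" "z \<in> X"
      using step(2) by (auto simp: linked_def)
    with False have yz: "{y, z} \<in> A \<or> {y, z} \<in> B"
      using perfect_matching_same_block[OF A, of X y z] perfect_matching_same_block[OF B, of X y z]
      by metis
    show ?thesis
    proof (cases "{y, z} \<in> (if s then A else B)")
      case True
      then have "((y, s), (z, \<not> s)) \<in> alternation A B" by (simp add: alternation_def)
      then show ?thesis using s by (meson rtrancl.rtrancl_into_rtrancl)
    next
      case False
      then have yz: "{y, z} \<in> (if s then B else A)" using yz by (auto split: if_splits)
      from s show ?thesis
      proof (cases rule: rtranclE)
        case base
        then have "y \<in> W" using yz perfect_matching_subset[OF B] by auto
        then show ?thesis using v base by simp
      next
        case (step q)
        obtain w r where q: "q = (w, r)" by fastforce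
        have r: "s = (\<not> r)" and w: "{w, y} \<in> (if s then B else A)"
          using step(2) q by (auto simp: alternation_def split: if_splits)
        have "w = z"
          using w yz perfect_matching_unique[OF A, of y w z] perfect_matching_unique[OF B, of y w z]
          by (auto simp: insert_commute split: if_splits)
        then show ?thesis using step(1) q by blast
      qed
    qed
  qed
qed

text \<open>Both \<open>x\<close> and \<open>y\<close> are reached by the same deterministic walk
  from \<open>v\<close>, so one state is reachable from the other; as neither state can be left,
  they agree.\<close>

lemma outer_partner_unique_aux:
  assumes A: "perfect_matching V A" and B: "perfect_matching W B"
    and v: "v \<in> V - W"
    and x: "x \<notin> V \<inter> W" "x \<noteq> v" "(v, x) \<in> (linked (A \<union> B))\<^sup>*"
    and y: "y \<notin> V \<inter> W" "y \<noteq> v" "(v, y) \<in> (linked (A \<union> B))\<^sup>*"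
  shows "x = y"
proof -
  \<comment> \<open>The walk arrives at \<open>z\<close> along one matching and would have to leave
    along the other, which does not cover \<open>z\<close>.\<close>
  have terminal: "q = (z, s)" if "z \<notin> V \<inter> W" "z \<noteq> v" "((v, True), (z, s)) \<in> (alternation A B)\<^sup>*"
    "((z, s), q) \<in> (alternation A B)\<^sup>*" for z s q
    using that(3)
  proof (cases rule: rtranclE)
    case base
    then show ?thesis using that(2) by simp
  next
    case (step p)
    have "((z, s), q') \<notin> alternation A B" for q'
    proof
      assume "((z, s), q') \<in> alternation A B"
      then obtain u where "{z, u} \<in> (if s then A else B)" by (cases q') (auto simp: alternation_def)
      moreover obtain w where "{w, z} \<in> (if s then B else A)"
        using step(2) by (cases p) (auto simp: alternation_def split: if_splits)
      ultimately show False
        using that(1) perfect_matching_subset[OF A] perfect_matching_subset[OF B]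
        by (auto split: if_splits; blast)
    qed
    with that(4) show ?thesis by (auto elim: converse_rtranclE)
  qed
  obtain s where s: "((v, True), (x, s)) \<in> (alternation A B)\<^sup>*"
    using linked_alternation[OF A B _ x(3)] v by blast
  obtain t where t: "((v, True), (y, t)) \<in> (alternation A B)\<^sup>*"
    using linked_alternation[OF A B _ y(3)] v by blast
  show ?thesis
    using single_valued_confluent[OF single_valued_alternation[OF A B] s t]
      terminal[OF x(1,2) s] terminal[OF y(1,2) t] by blast
qed

lemma outer_partner_unique:
  assumes "perfect_matching V A" "perfect_matching W B"
    and "v \<in> V \<union> W" "v \<notin> V \<inter> W"
    and "x \<notin> V \<inter> W" "x \<noteq> v" "(v, x) \<in> (linked (A \<union> B))\<^sup>*"
    and "y \<notin> V \<inter> W" "y \<noteq> v" "(v, y) \<in> (linked (A \<union> B))\<^sup>*"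
  shows "x = y"
proof (cases "v \<in> V")
  case True
  then show ?thesis
    using assms outer_partner_unique_aux[OF assms(1,2), of v x y] by blast
next
  case False
  then show ?thesis
    using assms outer_partner_unique_aux[OF assms(2,1), of v x y] by (simp add: Un_commute Int_commute)
qed

lemma linked_sym: "sym (linked P)"
  by (auto simp: sym_def linked_def)

lemma linked_closed_even:
  assumes P: "perfect_matching V P" "finite V"
    and closed: "\<And>x y. x \<in> C \<Longrightarrow> (x, y) \<in> linked P \<Longrightarrow> y \<in> C"
  shows "even (card (C \<inter> V))"
proof -
  have "\<Union>{X \<in> P. X \<subseteq> C} = C \<inter> V"
  proof (intro equalityI subsetI)
    fix x assume "x \<in> C \<inter> V"
    moreover obtain X where "X \<in> P" "x \<in> X"
      using calculation perfect_matching_Union[OF P(1)] by blast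
    ultimately show "x \<in> \<Union>{X \<in> P. X \<subseteq> C}"
      using closed[of x] by (auto simp: linked_def)
  next
    fix x assume "x \<in> \<Union>{X \<in> P. X \<subseteq> C}"
    then show "x \<in> C \<inter> V" using perfect_matching_Union[OF P(1)] by auto
  qed
  then show ?thesis
    using perfect_matching_even[OF perfect_matching_mono[OF P(1), of "{X \<in> P. X \<subseteq> C}"]] P(2) by auto
qed

text \<open>Parity replaces following the walk to its end. The component \<open>C\<close> of
  \<open>v\<close> is a union of blocks of either matching, so it meets \<open>V\<close> and
  \<open>W\<close> in even numbers of points. If \<open>v\<close> were its only outer vertex, the
  union of these two sets would have exactly one point more than their intersection, and the two
  even sizes would have an odd sum.\<close>

lemma outer_partner_exists:
  assumes A: "perfect_matching V A" and B: "perfect_matching W B" and fin: "finite V" "finite W"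
    and v: "v \<in> V \<union> W" "v \<notin> V \<inter> W"
  obtains x where "x \<in> V \<union> W" "x \<notin> V \<inter> W" "x \<noteq> v" "(v, x) \<in> (linked (A \<union> B))\<^sup>*"
proof (rule ccontr)
  assume none: "\<not> thesis"
  define C where "C = (linked (A \<union> B))\<^sup>* `` {v}"
  have closed: "y \<in> C" if "x \<in> C" "(x, y) \<in> linked (A \<union> B)" for x y
    using that unfolding C_def by (meson Image_singleton_iff rtrancl.rtrancl_into_rtrancl)
  have "even (card (C \<inter> V))" "even (card (C \<inter> W))"
    using closed by (intro linked_closed_even[OF A fin(1)] linked_closed_even[OF B fin(2)];
        auto simp: linked_def)+
  moreover have "(C \<inter> V) \<union> (C \<inter> W) = insert v ((C \<inter> V) \<inter> (C \<inter> W))"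
  proof (intro equalityI subsetI)
    fix x assume x: "x \<in> (C \<inter> V) \<union> (C \<inter> W)"
    then have "x \<in> V \<inter> W \<or> x = v" using none that[of x] by (auto simp: C_def)
    then show "x \<in> insert v ((C \<inter> V) \<inter> (C \<inter> W))" using x by auto
  next
    fix x assume "x \<in> insert v ((C \<inter> V) \<inter> (C \<inter> W))"
    moreover have "v \<in> C" by (simp add: C_def)
    ultimately show "x \<in> (C \<inter> V) \<union> (C \<inter> W)" using v(1) by auto
  qed
  then have "card ((C \<inter> V) \<union> (C \<inter> W)) = Suc (card ((C \<inter> V) \<inter> (C \<inter> W)))"
    using v fin by auto
  ultimately show False
    using card_Un_Int[of "C \<inter> V" "C \<inter> W"] fin by (metis even_Suc finite_Int odd_add add_Suc)
qed

section \<open>The Brauer monoid\<close>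

lemma carrier_brauer: "carrier (brauer n) = {\<alpha>. perfect_matching (vertices n) \<alpha>}"
  by (simp add: brauer_def perfect_matching_def)

lemma brauer_matching: "\<alpha> \<in> carrier (brauer n) \<Longrightarrow> perfect_matching (vertices n) \<alpha>"
  by (simp add: carrier_brauer)

lemma mult_brauer: "\<alpha> \<otimes>\<^bsub>brauer n\<^esub> \<beta> = brauer_mult n \<alpha> \<beta>"
  by (simp add: brauer_def)

lemma finite_vertices [simp]: "finite (vertices n)"
  by (simp add: vertices_def)

lemma finite_brauer: "finite (carrier (brauer n))"
proof (rule finite_subset)
  show "carrier (brauer n) \<subseteq> Pow (Pow (vertices n))"
    using perfect_matching_subset[OF brauer_matching] by blast
qed simp

lemma vertices_simps [simp]:
  "Up x \<in> vertices n \<longleftrightarrow> x \<in> {1..n}" "Low x \<in> vertices n \<longleftrightarrow> x \<in> {1..n}" "Mid x \<notin> vertices n"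
  by (auto simp: vertices_def)

definition product_graph :: "vertex set set \<Rightarrow> vertex set set \<Rightarrow> vertex set set" where
  "product_graph \<alpha> \<beta> = (`) low_to_mid ` \<alpha> \<union> (`) up_to_mid ` \<beta>"

lemma generated_equiv_eq: "generated_equiv P = (linked P)\<^sup>*"
  by (simp add: generated_equiv_def linked_def)

lemma low_to_mid_matching:
  assumes "\<alpha> \<in> carrier (brauer n)"
  shows "perfect_matching (Up ` {1..n} \<union> Mid ` {1..n}) ((`) low_to_mid ` \<alpha>)"
proof -
  have "low_to_mid ` vertices n = Up ` {1..n} \<union> Mid ` {1..n}"
    by (force simp: vertices_def)
  moreover have "inj_on low_to_mid (vertices n)"
    by (auto simp: inj_on_def vertices_def)
  ultimately show ?thesis using perfect_matching_image[OF brauer_matching[OF assms]] by metis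
qed

lemma up_to_mid_matching:
  assumes "\<alpha> \<in> carrier (brauer n)"
  shows "perfect_matching (Mid ` {1..n} \<union> Low ` {1..n}) ((`) up_to_mid ` \<alpha>)"
proof -
  have "up_to_mid ` vertices n = Mid ` {1..n} \<union> Low ` {1..n}"
    by (force simp: vertices_def)
  moreover have "inj_on up_to_mid (vertices n)"
    by (auto simp: inj_on_def vertices_def)
  ultimately show ?thesis using perfect_matching_image[OF brauer_matching[OF assms]] by metis
qed

definition product_rel :: "nat \<Rightarrow> vertex set set \<Rightarrow> vertex set set \<Rightarrow> (vertex \<times> vertex) set" where
  "product_rel n \<alpha> \<beta> =
     {(x, y) \<in> vertices n \<times> vertices n. (x, y) \<in> (linked (product_graph \<alpha> \<beta>))\<^sup>*}"

lemma brauer_mult_eq: "brauer_mult n \<alpha> \<beta> = vertices n // product_rel n \<alpha> \<beta>"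
  by (simp add: brauer_mult_def product_rel_def generated_equiv_eq product_graph_def)

lemma equiv_product_rel: "equiv (vertices n) (product_rel n \<alpha> \<beta>)"
proof -
  have "sym ((linked (product_graph \<alpha> \<beta>))\<^sup>*)" by (intro sym_rtrancl linked_sym)
  then show ?thesis
    by (intro equivI) (auto simp: product_rel_def refl_on_def sym_def trans_def intro: rtrancl_trans)
qed

text \<open>The two renamed diagrams overlap exactly in the middle row, so the vertices of the
  product are the outer ones. Each is connected to exactly one other outer vertex, hence classes of
  size 2.\<close>

lemma brauer_mult_matching:
  assumes a: "\<alpha> \<in> carrier (brauer n)" and b: "\<beta> \<in> carrier (brauer n)"
  shows "perfect_matching (vertices n) (brauer_mult n \<alpha> \<beta>)"
proof -
  let ?V = "Up ` {1..n} \<union> Mid ` {1..n}" and ?W = "Mid ` {1..n} \<union> Low ` {1..n}"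
  have outer: "x \<in> ?V \<union> ?W \<and> x \<notin> ?V \<inter> ?W \<longleftrightarrow> x \<in> vertices n" for x
    by (auto simp: vertices_def)
  have "card (product_rel n \<alpha> \<beta> `` {v}) = 2" if v: "v \<in> vertices n" for v
  proof -
    have v': "v \<in> ?V \<union> ?W" "v \<notin> ?V \<inter> ?W" using outer[of v] v by blast+
    obtain x where x: "x \<in> ?V \<union> ?W" "x \<notin> ?V \<inter> ?W" "x \<noteq> v"
        "(v, x) \<in> (linked (product_graph \<alpha> \<beta>))\<^sup>*"
      by (rule outer_partner_exists[OF low_to_mid_matching[OF a] up_to_mid_matching[OF b] _ _ v',
            folded product_graph_def]) auto
    have xv: "x \<in> vertices n" using outer[of x] x(1,2) by blast
    have "y = x" if "y \<in> vertices n" "y \<noteq> v" "(v, y) \<in> (linked (product_graph \<alpha> \<beta>))\<^sup>*" for y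
    proof (rule outer_partner_unique[OF low_to_mid_matching[OF a] up_to_mid_matching[OF b] v',
          folded product_graph_def])
      show "y \<notin> ?V \<inter> ?W" using outer[of y] that(1) by blast
    qed (use that x in simp_all)
    then have "product_rel n \<alpha> \<beta> `` {v} \<subseteq> {v, x}" by (auto simp only: product_rel_def)
    then have "product_rel n \<alpha> \<beta> `` {v} = {v, x}"
      using v x(4) xv by (auto simp: product_rel_def)
    then show ?thesis using x(3) by auto
  qed
  then show ?thesis
    using partition_on_quotient[OF equiv_product_rel]
    by (auto simp: perfect_matching_def brauer_mult_eq quotient_def)
qed

lemma brauer_closed [simp]:
  "\<alpha> \<in> carrier (brauer n) \<Longrightarrow> \<beta> \<in> carrier (brauer n) \<Longrightarrow> \<alpha> \<otimes>\<^bsub>brauer n\<^esub> \<beta> \<in> carrier (brauer n)"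
  by (simp add: carrier_brauer mult_brauer brauer_mult_matching)

text \<open>Blocks of a product are known to have two elements, so exhibiting one path determines a
  whole block and no closure has to be computed.\<close>

lemma product_blockI:
  assumes "\<alpha> \<in> carrier (brauer n)" "\<beta> \<in> carrier (brauer n)"
    and "x \<in> vertices n" "y \<in> vertices n" "x \<noteq> y" "(x, y) \<in> (linked (product_graph \<alpha> \<beta>))\<^sup>*"
  shows "{x, y} \<in> \<alpha> \<otimes>\<^bsub>brauer n\<^esub> \<beta>"
proof -
  let ?B = "product_rel n \<alpha> \<beta> `` {x}"
  have "?B \<in> brauer_mult n \<alpha> \<beta>" using assms(3) by (simp add: brauer_mult_eq quotientI)
  moreover have "x \<in> ?B" "y \<in> ?B" using assms(3-6) by (auto simp: product_rel_def)
  ultimately have "?B = {x, y}"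
    using perfect_matching_same_block[OF brauer_mult_matching[OF assms(1,2)]] assms(5) by blast
  then show ?thesis using \<open>?B \<in> _\<close> by (simp add: mult_brauer)
qed

lemma product_blockD:
  assumes "{x, y} \<in> \<alpha> \<otimes>\<^bsub>brauer n\<^esub> \<beta>"
  shows "(x, y) \<in> (linked (product_graph \<alpha> \<beta>))\<^sup>*"
proof -
  obtain z where "{x, y} = product_rel n \<alpha> \<beta> `` {z}" "z \<in> vertices n"
    using assms by (auto simp: mult_brauer brauer_mult_eq quotient_def)
  then have "(z, x) \<in> product_rel n \<alpha> \<beta>" "(z, y) \<in> product_rel n \<alpha> \<beta>" by auto
  then have "(x, y) \<in> product_rel n \<alpha> \<beta>"
    using equiv_product_rel[of n \<alpha> \<beta>] by (meson equivE symD transD)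
  then show ?thesis by (simp add: product_rel_def)
qed

section \<open>Blocks of a product obtained from short paths\<close>

lemma linked_image:
  "{u, v} \<in> \<alpha> \<Longrightarrow> (f u, f v) \<in> linked ((`) f ` \<alpha>)"
  unfolding linked_def by (intro CollectI case_prodI bexI[of _ "f ` {u, v}"] imageI) simp_all

lemma linked_mono: "P \<subseteq> Q \<Longrightarrow> linked P \<subseteq> linked Q"
  by (auto simp: linked_def)

lemma product_graph_left:
  assumes "{x, y} \<in> \<alpha>"
  shows "(low_to_mid x, low_to_mid y) \<in> linked (product_graph \<alpha> \<beta>)"
  using linked_image[OF assms] by (rule subsetD[OF linked_mono, rotated]) (simp add: product_graph_def)

lemma product_graph_right:
  assumes "{x, y} \<in> \<beta>"
  shows "(up_to_mid x, up_to_mid y) \<in> linked (product_graph \<alpha> \<beta>)"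
  using linked_image[OF assms] by (rule subsetD[OF linked_mono, rotated]) (simp add: product_graph_def)

lemma brauer_block_vertices:
  assumes "\<alpha> \<in> carrier (brauer n)" "{x, y} \<in> \<alpha>"
  shows "x \<in> vertices n \<and> y \<in> vertices n \<and> x \<noteq> y"
  using perfect_matching_subset[OF brauer_matching[OF assms(1)] assms(2)]
    perfect_matching_neq[OF brauer_matching[OF assms(1)] assms(2)] by simp

lemma product_up_up:
  assumes "\<alpha> \<in> carrier (brauer n)" "\<beta> \<in> carrier (brauer n)" "{Up x, Up y} \<in> \<alpha>"
  shows "{Up x, Up y} \<in> \<alpha> \<otimes>\<^bsub>brauer n\<^esub> \<beta>"
  using product_graph_left[OF assms(3), of \<beta>] brauer_block_vertices[OF assms(1,3)]
  by (intro product_blockI assms) auto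

lemma product_low_low:
  assumes "\<alpha> \<in> carrier (brauer n)" "\<beta> \<in> carrier (brauer n)" "{Low x, Low y} \<in> \<beta>"
  shows "{Low x, Low y} \<in> \<alpha> \<otimes>\<^bsub>brauer n\<^esub> \<beta>"
  using product_graph_right[OF assms(3), of \<alpha>] brauer_block_vertices[OF assms(2,3)]
  by (intro product_blockI assms) auto

lemma product_through:
  assumes "\<alpha> \<in> carrier (brauer n)" "\<beta> \<in> carrier (brauer n)" "{Up x, Low y} \<in> \<alpha>" "{Up y, Low z} \<in> \<beta>"
  shows "{Up x, Low z} \<in> \<alpha> \<otimes>\<^bsub>brauer n\<^esub> \<beta>"
  using product_graph_left[OF assms(3), of \<beta>] brauer_block_vertices[OF assms(1,3)]
    product_graph_right[OF assms(4), of \<alpha>] brauer_block_vertices[OF assms(2,4)]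
  by (intro product_blockI assms) auto

lemma product_cap:
  assumes "\<alpha> \<in> carrier (brauer n)" "\<beta> \<in> carrier (brauer n)"
    "{Up x, Low a} \<in> \<alpha>" "{Up y, Low b} \<in> \<alpha>" "{Up a, Up b} \<in> \<beta>"
  shows "{Up x, Up y} \<in> \<alpha> \<otimes>\<^bsub>brauer n\<^esub> \<beta>"
proof (intro product_blockI assms)
  have "{Low b, Up y} \<in> \<alpha>" using assms(4) by (simp add: insert_commute)
  then show "(Up x, Up y) \<in> (linked (product_graph \<alpha> \<beta>))\<^sup>*"
    using product_graph_left[OF assms(3), of \<beta>] product_graph_right[OF assms(5), of \<alpha>]
      product_graph_left[of "Low b" "Up y" \<alpha> \<beta>]
    by (auto intro: rtrancl_trans)
  show "Up x \<noteq> Up y"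
    using assms(3,4) brauer_block_vertices[OF assms(2,5)]
      perfect_matching_unique[OF brauer_matching[OF assms(1)], of "Up x" "Low a" "Low b"] by auto
qed (use brauer_block_vertices[OF assms(1,3)] brauer_block_vertices[OF assms(1,4)] in auto)

lemma product_cup:
  assumes "\<alpha> \<in> carrier (brauer n)" "\<beta> \<in> carrier (brauer n)"
    "{Low a, Low b} \<in> \<alpha>" "{Up a, Low x} \<in> \<beta>" "{Up b, Low y} \<in> \<beta>"
  shows "{Low x, Low y} \<in> \<alpha> \<otimes>\<^bsub>brauer n\<^esub> \<beta>"
proof (intro product_blockI assms)
  have *: "{Low x, Up a} \<in> \<beta>" "{Low y, Up b} \<in> \<beta>" using assms(4,5) by (simp_all add: insert_commute)
  then show "(Low x, Low y) \<in> (linked (product_graph \<alpha> \<beta>))\<^sup>*"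
    using product_graph_left[OF assms(3), of \<beta>] product_graph_right[OF assms(5), of \<alpha>]
      product_graph_right[of "Low x" "Up a" \<beta> \<alpha>]
    by (auto intro: rtrancl_trans)
  show "Low x \<noteq> Low y"
    using * brauer_block_vertices[OF assms(1,3)]
      perfect_matching_unique[OF brauer_matching[OF assms(2)], of "Low x" "Up a" "Up b"] by auto
qed (use brauer_block_vertices[OF assms(2,4)] brauer_block_vertices[OF assms(2,5)] in auto)

text \<open>The longest explicit path that is used: \<open>same_action_hook\<close> sends the line
  from 1 through an upper hook of the right factor and back down to one of its through
  lines.\<close>

lemma product_zigzag:
  assumes "\<alpha> \<in> carrier (brauer n)" "\<beta> \<in> carrier (brauer n)"
    "{Up x, Low a} \<in> \<alpha>" "{Up a, Up b} \<in> \<beta>" "{Low b, Low c} \<in> \<alpha>" "{Up c, Low y} \<in> \<beta>"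
  shows "{Up x, Low y} \<in> \<alpha> \<otimes>\<^bsub>brauer n\<^esub> \<beta>"
proof (intro product_blockI assms)
  have "(Up x, Mid a) \<in> (linked (product_graph \<alpha> \<beta>))\<^sup>*" "(Mid a, Mid b) \<in> (linked (product_graph \<alpha> \<beta>))\<^sup>*"
    "(Mid b, Mid c) \<in> (linked (product_graph \<alpha> \<beta>))\<^sup>*" "(Mid c, Low y) \<in> (linked (product_graph \<alpha> \<beta>))\<^sup>*"
    using product_graph_left[OF assms(3), of \<beta>] product_graph_right[OF assms(4), of \<alpha>]
      product_graph_left[OF assms(5), of \<beta>] product_graph_right[OF assms(6), of \<alpha>] by auto
  then show "(Up x, Low y) \<in> (linked (product_graph \<alpha> \<beta>))\<^sup>*" by (meson rtrancl_trans)
qed (use brauer_block_vertices[OF assms(1,3)] brauer_block_vertices[OF assms(2,6)] in auto)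

subsection \<open>Associativity\<close>

text \<open>Transports a path edge by edge into another graph. The closure \<open>R\<^sup>*\<close>
  in the assumptions lets a block that is itself a product expand into a longer path; the case
  \<open>u = v\<close> arises because \<open>linked\<close> relates each point of a block to
  itself.\<close>

lemma product_graph_image_path:
  assumes "(x, y) \<in> (linked (product_graph \<alpha> \<beta>))\<^sup>*"
    and "\<And>u v. {u, v} \<in> \<alpha> \<Longrightarrow> (f (low_to_mid u), f (low_to_mid v)) \<in> R\<^sup>*"
    and "\<And>u v. {u, v} \<in> \<beta> \<Longrightarrow> (f (up_to_mid u), f (up_to_mid v)) \<in> R\<^sup>*"
    and "\<alpha> \<in> carrier (brauer n)" "\<beta> \<in> carrier (brauer n)"
  shows "(f x, f y) \<in> R\<^sup>*"
  using assms(1)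
proof (induction rule: rtrancl_induct)
  case (step y z)
  obtain B where B: "B \<in> product_graph \<alpha> \<beta>" "y \<in> B" "z \<in> B"
    using step(2) by (auto simp: linked_def)
  have "(f y, f z) \<in> R\<^sup>*"
  proof (cases "\<exists>X\<in>\<alpha>. B = low_to_mid ` X")
    case True
    then obtain X u v where "X \<in> \<alpha>" "B = low_to_mid ` X" "u \<in> X" "y = low_to_mid u"
      "v \<in> X" "z = low_to_mid v" using B by auto
    then show ?thesis
      using assms(2)[of u v] perfect_matching_same_block[OF brauer_matching[OF assms(4)], of X u v]
      by (cases "u = v") auto
  next
    case False
    then obtain X u v where "X \<in> \<beta>" "B = up_to_mid ` X" "u \<in> X" "y = up_to_mid u"
      "v \<in> X" "z = up_to_mid v" using B by (auto simp: product_graph_def)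
    then show ?thesis
      using assms(3)[of u v] perfect_matching_same_block[OF brauer_matching[OF assms(5)], of X u v]
      by (cases "u = v") auto
  qed
  then show ?case using step by (meson rtrancl_trans)
qed simp

text \<open>Puts a diagram between rows \<open>i\<close> and \<open>k\<close> of a stack. Row
  \<open>j\<close> is for middle vertices only, so it is an arbitrary dummy (usually 0) when an
  unrenamed diagram is placed.\<close>

fun place :: "nat \<Rightarrow> nat \<Rightarrow> nat \<Rightarrow> vertex \<Rightarrow> nat \<times> nat" where
  "place i j k (Up x) = (i, x)"
| "place i j k (Mid x) = (j, x)"
| "place i j k (Low x) = (k, x)"

lemma place_matching:
  assumes "\<alpha> \<in> carrier (brauer n)" "i \<noteq> k"
  shows "perfect_matching ({i, k} \<times> {1..n}) ((`) (place i j k) ` \<alpha>)"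
proof -
  have "place i j k ` vertices n = {i, k} \<times> {1..n}" by (force simp: vertices_def)
  moreover have "inj_on (place i j k) (vertices n)" using assms(2) by (auto simp: inj_on_def vertices_def)
  ultimately show ?thesis using perfect_matching_image[OF brauer_matching[OF assms(1)]] by metis
qed

text \<open>
  Stacking three diagrams gives a graph on four rows that is again a union of two matchings, the
  outer diagrams against the middle one. A block of either bracketing joins two vertices of the top
  and bottom rows that are connected in this graph, and such a connection determines its endpoints.
\<close>

lemma brauer_assoc:
  assumes a: "\<alpha> \<in> carrier (brauer n)" and b: "\<beta> \<in> carrier (brauer n)" and c: "\<gamma> \<in> carrier (brauer n)"
  shows "(\<alpha> \<otimes>\<^bsub>brauer n\<^esub> \<beta>) \<otimes>\<^bsub>brauer n\<^esub> \<gamma> = \<alpha> \<otimes>\<^bsub>brauer n\<^esub> (\<beta> \<otimes>\<^bsub>brauer n\<^esub> \<gamma>)"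
    (is "?L = ?R")
proof -
  define A where "A = (`) (place 0 0 1) ` \<alpha> \<union> (`) (place 2 0 3) ` \<gamma>"
  define B where "B = (`) (place 1 0 2) ` \<beta>"
  let ?E = "linked (A \<union> B)"
  let ?V = "{0, 1} \<times> {1..n} \<union> {2, 3} \<times> {1..n}" and ?W = "{1, 2} \<times> {1..n}"
  have A: "perfect_matching ?V A" unfolding A_def
    by (intro perfect_matching_Un place_matching a c) auto
  have B: "perfect_matching ?W B" unfolding B_def by (intro place_matching b) auto
  have ab: "\<alpha> \<otimes>\<^bsub>brauer n\<^esub> \<beta> \<in> carrier (brauer n)" and bc: "\<beta> \<otimes>\<^bsub>brauer n\<^esub> \<gamma> \<in> carrier (brauer n)"
    using a b c by simp_all
  have ea: "(place 0 0 1 u, place 0 0 1 v) \<in> ?E\<^sup>*" if "{u, v} \<in> \<alpha>" for u v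
    using linked_image[OF that, of "place 0 0 1"] linked_mono[of "(`) (place 0 0 1) ` \<alpha>" "A \<union> B"]
    by (auto simp: A_def)
  have eb: "(place 1 0 2 u, place 1 0 2 v) \<in> ?E\<^sup>*" if "{u, v} \<in> \<beta>" for u v
    using linked_image[OF that, of "place 1 0 2"] linked_mono[of "(`) (place 1 0 2) ` \<beta>" "A \<union> B"]
    by (auto simp: B_def)
  have ec: "(place 2 0 3 u, place 2 0 3 v) \<in> ?E\<^sup>*" if "{u, v} \<in> \<gamma>" for u v
    using linked_image[OF that, of "place 2 0 3"] linked_mono[of "(`) (place 2 0 3) ` \<gamma>" "A \<union> B"]
    by (auto simp: A_def)
  \<comment> \<open>Renaming the lower row to the middle and then placing amounts to placing the
    lower row on row \<open>j\<close>; \<open>l\<close> is a dummy since \<open>u\<close> is not a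
    middle vertex.\<close>
  have low: "place i j k (low_to_mid u) = place i l j u" if "u \<in> vertices n" for i j k l u
    using that by (cases u) auto
  have up: "place i j k (up_to_mid u) = place j l k u" if "u \<in> vertices n" for i j k l u
    using that by (cases u) auto
  have eab: "(place 0 1 2 u, place 0 1 2 v) \<in> ?E\<^sup>*" if "{u, v} \<in> \<alpha> \<otimes>\<^bsub>brauer n\<^esub> \<beta>" for u v
  proof (rule product_graph_image_path[OF product_blockD[OF that] _ _ a b])
    fix u v assume "{u, v} \<in> \<alpha>"
    then show "(place 0 1 2 (low_to_mid u), place 0 1 2 (low_to_mid v)) \<in> ?E\<^sup>*"
      using ea brauer_block_vertices[OF a] low[of u 0 1 2 0] low[of v 0 1 2 0] by auto
  next
    fix u v assume "{u, v} \<in> \<beta>"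
    then show "(place 0 1 2 (up_to_mid u), place 0 1 2 (up_to_mid v)) \<in> ?E\<^sup>*"
      using eb brauer_block_vertices[OF b] up[of u 0 1 2 0] up[of v 0 1 2 0] by auto
  qed
  have ebc: "(place 1 2 3 u, place 1 2 3 v) \<in> ?E\<^sup>*" if "{u, v} \<in> \<beta> \<otimes>\<^bsub>brauer n\<^esub> \<gamma>" for u v
  proof (rule product_graph_image_path[OF product_blockD[OF that] _ _ b c])
    fix u v assume "{u, v} \<in> \<beta>"
    then show "(place 1 2 3 (low_to_mid u), place 1 2 3 (low_to_mid v)) \<in> ?E\<^sup>*"
      using eb brauer_block_vertices[OF b] low[of u 1 2 3 0] low[of v 1 2 3 0] by auto
  next
    fix u v assume "{u, v} \<in> \<gamma>"
    then show "(place 1 2 3 (up_to_mid u), place 1 2 3 (up_to_mid v)) \<in> ?E\<^sup>*"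
      using ec brauer_block_vertices[OF c] up[of u 1 2 3 0] up[of v 1 2 3 0] by auto
  qed
  have eL: "(place 0 2 3 u, place 0 2 3 v) \<in> ?E\<^sup>*" if "{u, v} \<in> ?L" for u v
  proof (rule product_graph_image_path[OF product_blockD[OF that] _ _ ab c])
    fix u v assume "{u, v} \<in> \<alpha> \<otimes>\<^bsub>brauer n\<^esub> \<beta>"
    then show "(place 0 2 3 (low_to_mid u), place 0 2 3 (low_to_mid v)) \<in> ?E\<^sup>*"
      using eab brauer_block_vertices[OF ab] low[of u 0 2 3 1] low[of v 0 2 3 1] by auto
  next
    fix u v assume "{u, v} \<in> \<gamma>"
    then show "(place 0 2 3 (up_to_mid u), place 0 2 3 (up_to_mid v)) \<in> ?E\<^sup>*"
      using ec brauer_block_vertices[OF c] up[of u 0 2 3 0] up[of v 0 2 3 0] by auto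
  qed
  have eR: "(place 0 1 3 u, place 0 1 3 v) \<in> ?E\<^sup>*" if "{u, v} \<in> ?R" for u v
  proof (rule product_graph_image_path[OF product_blockD[OF that] _ _ a bc])
    fix u v assume "{u, v} \<in> \<alpha>"
    then show "(place 0 1 3 (low_to_mid u), place 0 1 3 (low_to_mid v)) \<in> ?E\<^sup>*"
      using ea brauer_block_vertices[OF a] low[of u 0 1 3 0] low[of v 0 1 3 0] by auto
  next
    fix u v assume "{u, v} \<in> \<beta> \<otimes>\<^bsub>brauer n\<^esub> \<gamma>"
    then show "(place 0 1 3 (up_to_mid u), place 0 1 3 (up_to_mid v)) \<in> ?E\<^sup>*"
      using ebc brauer_block_vertices[OF bc] up[of u 0 1 3 2] up[of v 0 1 3 2] by auto
  qed
  have L: "perfect_matching (vertices n) ?L" and R: "perfect_matching (vertices n) ?R"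
    using a b c by (simp_all add: brauer_matching)
  have "?L \<subseteq> ?R"
  proof
    fix X assume X: "X \<in> ?L"
    then obtain u v where uv: "X = {u, v}" "u \<noteq> v" "u \<in> vertices n" "v \<in> vertices n"
      using perfect_matching_block[OF L] by metis
    obtain w where w: "{u, w} \<in> ?R" "w \<noteq> u" "w \<in> vertices n"
      using perfect_matching_partner[OF R uv(3)] by metis
    let ?p = "place 0 0 3"
    have p: "place 0 i 3 x = ?p x" if "x \<in> vertices n" for x i using that by (cases x) auto
    have outer: "?p x \<in> ?V \<union> ?W" "?p x \<notin> ?V \<inter> ?W" if "x \<in> vertices n" for x
      using that by (cases x; simp)+
    have inj: "x = y" if "x \<in> vertices n" "y \<in> vertices n" "?p x = ?p y" for x y
      using that by (cases x; cases y) auto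
    have "?p v = ?p w"
    proof (rule outer_partner_unique[OF A B outer[OF uv(3)]])
      show "(?p u, ?p v) \<in> ?E\<^sup>*" using eL[of u v] X uv(1) p[OF uv(3), of 2] p[OF uv(4), of 2] by simp
      show "(?p u, ?p w) \<in> ?E\<^sup>*" using eR[of u w] w(1) p[OF uv(3), of 1] p[OF w(3), of 1] by simp
      show "?p v \<notin> ?V \<inter> ?W" "?p w \<notin> ?V \<inter> ?W" using outer(2)[OF uv(4)] outer(2)[OF w(3)] by blast+
      show "?p v \<noteq> ?p u" "?p w \<noteq> ?p u" using inj[OF uv(4,3)] inj[OF w(3) uv(3)] uv(2) w(2) by blast+
    qed
    then have "v = w" by (rule inj[OF uv(4) w(3)])
    then show "X \<in> ?R" using uv(1) w(1) by simp
  qed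
  then show ?thesis using perfect_matching_eqI[OF L R] by blast
qed

section \<open>Upper hooks, lower hooks and through lines\<close>

lemma brauer_block_cases:
  assumes "\<alpha> \<in> carrier (brauer n)" "B \<in> \<alpha>"
  obtains (upper) x y where "B = {Up x, Up y}" "x \<in> {1..n}" "y \<in> {1..n}" "x \<noteq> y"
  | (lower) x y where "B = {Low x, Low y}" "x \<in> {1..n}" "y \<in> {1..n}" "x \<noteq> y"
  | (through) x y where "B = {Up x, Low y}" "x \<in> {1..n}" "y \<in> {1..n}"
proof -
  obtain u v where uv: "B = {u, v}" "u \<noteq> v" "u \<in> vertices n" "v \<in> vertices n"
    using perfect_matching_block[OF brauer_matching[OF assms(1)] assms(2)] by metis
  consider x y where "u = Up x" "v = Up y" | x y where "u = Low x" "v = Low y"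
    | x y where "u = Up x" "v = Low y" | x y where "u = Low x" "v = Up y"
    using uv(3,4) by (cases u; cases v) auto
  then show thesis
  proof cases
    case 1 then show thesis using uv upper by simp
  next
    case 2 then show thesis using uv lower by simp
  next
    case 3 then show thesis using uv through by simp
  next
    case 4 then show thesis using uv through by (simp add: insert_commute)
  qed
qed

lemma brauer_unique:
  assumes "\<alpha> \<in> carrier (brauer n)" "{x, y} \<in> \<alpha>" "{x, z} \<in> \<alpha>"
  shows "y = z"
  by (rule perfect_matching_unique[OF brauer_matching[OF assms(1)] assms(2,3)])

lemma brauer_unique':
  assumes "\<alpha> \<in> carrier (brauer n)" "{y, x} \<in> \<alpha>" "{z, x} \<in> \<alpha>"
  shows "y = z"
  using assms brauer_unique[of \<alpha> n x y z] by (simp add: insert_commute)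

lemma brauer_up_cases:
  assumes "\<alpha> \<in> carrier (brauer n)" "x \<in> {1..n}"
  obtains (upper) y where "{Up x, Up y} \<in> \<alpha>" | (through) y where "{Up x, Low y} \<in> \<alpha>"
proof -
  obtain v where v: "{Up x, v} \<in> \<alpha>" "v \<in> vertices n"
    using perfect_matching_partner[OF brauer_matching[OF assms(1)], of "Up x"] assms(2) by auto
  then show thesis using upper through by (cases v) auto
qed

lemma brauer_low_cases:
  assumes "\<alpha> \<in> carrier (brauer n)" "x \<in> {1..n}"
  obtains (lower) y where "{Low x, Low y} \<in> \<alpha>" | (through) y where "{Up y, Low x} \<in> \<alpha>"
proof -
  obtain v where v: "{Low x, v} \<in> \<alpha>" "v \<in> vertices n"
    using perfect_matching_partner[OF brauer_matching[OF assms(1)], of "Low x"] assms(2) by auto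
  then show thesis using lower through by (cases v) (auto simp: insert_commute)
qed

lemma brauer_eqI:
  assumes a: "\<alpha> \<in> carrier (brauer n)" and b: "\<beta> \<in> carrier (brauer n)"
    and "\<And>x y. {Up x, Up y} \<in> \<alpha> \<Longrightarrow> {Up x, Up y} \<in> \<beta>"
    and "\<And>x y. {Low x, Low y} \<in> \<alpha> \<Longrightarrow> {Low x, Low y} \<in> \<beta>"
    and "\<And>x y. {Up x, Low y} \<in> \<alpha> \<Longrightarrow> {Up x, Low y} \<in> \<beta>"
  shows "\<alpha> = \<beta>"
proof (rule perfect_matching_eqI[OF brauer_matching[OF a] brauer_matching[OF b]], rule subsetI)
  fix B assume B: "B \<in> \<alpha>"
  from a B show "B \<in> \<beta>" by (cases rule: brauer_block_cases) (use assms(3-5) B in auto)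
qed

subsection \<open>Symmetric diagrams\<close>

text \<open>Equal hooks in both rows and vertical lines elsewhere. The identity
  (\<open>M = {}\<close>), \<open>zeta n\<close>, \<open>eps n\<close> and the projections attached
  to classes are all of this form.\<close>

definition diagram :: "nat \<Rightarrow> nat set set \<Rightarrow> vertex set set" where
  "diagram n M = (`) Up ` M \<union> (`) Low ` M \<union> (\<lambda>x. {Up x, Low x}) ` ({1..n} - \<Union>M)"

lemma inj_Up: "inj Up" and inj_Low: "inj Low"
  by (auto simp: inj_def)

lemma Up_image_doubleton: "Up ` X = {Up x, Up y} \<longleftrightarrow> X = {x, y}"
  using inj_image_eq_iff[OF inj_Up, of X "{x, y}"] by simp

lemma Low_image_doubleton: "Low ` X = {Low x, Low y} \<longleftrightarrow> X = {x, y}"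
  using inj_image_eq_iff[OF inj_Low, of X "{x, y}"] by simp

lemma not_Up_image: "Up ` X \<noteq> insert (Low x) Y" "Up ` X \<noteq> {y, Low x}"
  by auto

lemma not_Low_image: "Low ` X \<noteq> insert (Up x) Y" "Low ` X \<noteq> {y, Up x}"
  by auto

lemma diagram_upper [simp]: "{Up x, Up y} \<in> diagram n M \<longleftrightarrow> {x, y} \<in> M"
proof -
  have "{Up x, Up y} \<in> (`) Up ` M \<longleftrightarrow> {x, y} \<in> M"
  proof
    assume "{Up x, Up y} \<in> (`) Up ` M"
    then obtain X where "X \<in> M" "{Up x, Up y} = Up ` X" by (rule imageE)
    then show "{x, y} \<in> M" using Up_image_doubleton[of X x y] by simp
  next
    assume "{x, y} \<in> M"
    then have "Up ` {x, y} \<in> (`) Up ` M" by (rule imageI)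
    then show "{Up x, Up y} \<in> (`) Up ` M" by simp
  qed
  then show ?thesis using not_Low_image by (auto simp: diagram_def doubleton_eq_iff image_iff)
qed

lemma diagram_lower [simp]: "{Low x, Low y} \<in> diagram n M \<longleftrightarrow> {x, y} \<in> M"
proof -
  have "{Low x, Low y} \<in> (`) Low ` M \<longleftrightarrow> {x, y} \<in> M"
  proof
    assume "{Low x, Low y} \<in> (`) Low ` M"
    then obtain X where "X \<in> M" "{Low x, Low y} = Low ` X" by (rule imageE)
    then show "{x, y} \<in> M" using Low_image_doubleton[of X x y] by simp
  next
    assume "{x, y} \<in> M"
    then have "Low ` {x, y} \<in> (`) Low ` M" by (rule imageI)
    then show "{Low x, Low y} \<in> (`) Low ` M" by simp
  qed
  then show ?thesis using not_Up_image by (auto simp: diagram_def doubleton_eq_iff image_iff)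
qed

lemma diagram_through [simp]: "{Up x, Low y} \<in> diagram n M \<longleftrightarrow> x = y \<and> x \<in> {1..n} - \<Union>M"
  using not_Up_image not_Low_image by (auto simp: diagram_def doubleton_eq_iff image_iff)

lemma diagram_carrier:
  assumes "perfect_matching W M" "W \<subseteq> {1..n}"
  shows "diagram n M \<in> carrier (brauer n)"
proof -
  let ?R = "{1..n} - W"
  have "perfect_matching ((Up ` ?R) \<union> (Low ` ?R)) ((\<lambda>x. {Up x, Low x}) ` ?R)"
    unfolding perfect_matching_def by (auto simp: partition_on_def disjoint_def)
  then have "perfect_matching (Up ` W \<union> Low ` W \<union> (Up ` ?R \<union> Low ` ?R)) (diagram n M)"
    unfolding diagram_def using perfect_matching_Union[OF assms(1)]
    by (intro perfect_matching_Un perfect_matching_image assms(1) inj_on_subset[OF inj_Up subset_UNIV]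
        inj_on_subset[OF inj_Low subset_UNIV]) auto
  moreover have "Up ` W \<union> Low ` W \<union> (Up ` ?R \<union> Low ` ?R) = vertices n"
    using assms(2) by (auto simp: vertices_def)
  ultimately show ?thesis by (simp add: carrier_brauer)
qed

text \<open>The left factor repeats upper hooks that \<alpha> already has and passes everything else
  straight down. This yields the left identity law, the idempotence of \<open>diagram n M\<close>
  and the normal form in \<open>eps_mult_hooked\<close>.\<close>

lemma diagram_mult_left:
  assumes M: "perfect_matching W M" "W \<subseteq> {1..n}" and a: "\<alpha> \<in> carrier (brauer n)"
    and sub: "\<And>x y. {x, y} \<in> M \<Longrightarrow> {Up x, Up y} \<in> \<alpha>"
  shows "diagram n M \<otimes>\<^bsub>brauer n\<^esub> \<alpha> = \<alpha>"
proof -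
  have d: "diagram n M \<in> carrier (brauer n)" by (rule diagram_carrier[OF M])
  \<comment> \<open>A point covered by \<open>M\<close> has the same partner in \<alpha> as in
    \<open>M\<close>, so an upper hook of \<alpha> either belongs to \<open>M\<close> or avoids
    it.\<close>
  have inM: "\<exists>z. v = Up z \<and> {x, z} \<in> M" if "x \<in> \<Union>M" "{Up x, v} \<in> \<alpha>" for x v
  proof -
    have "x \<in> W" using that(1) perfect_matching_Union[OF M(1)] by simp
    then obtain z where z: "{x, z} \<in> M" using perfect_matching_partner[OF M(1)] by metis
    then show ?thesis using brauer_unique[OF a sub[OF z] that(2)] by blast
  qed
  show ?thesis
  proof (rule brauer_eqI[OF a brauer_closed[OF d a], symmetric])
    fix x y assume xy: "{Up x, Up y} \<in> \<alpha>"
    then have yx: "{Up y, Up x} \<in> \<alpha>" by (simp add: insert_commute)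
    show "{Up x, Up y} \<in> diagram n M \<otimes>\<^bsub>brauer n\<^esub> \<alpha>"
    proof (cases "x \<in> \<Union>M \<or> y \<in> \<Union>M")
      case True
      then have "{x, y} \<in> M" using inM[OF _ xy] inM[OF _ yx] by (auto simp: insert_commute)
      then show ?thesis by (intro product_up_up d a) simp
    next
      case False
      then show ?thesis using brauer_block_vertices[OF a xy]
        by (intro product_cap[OF d a _ _ xy]) simp_all
    qed
  next
    fix x y assume "{Low x, Low y} \<in> \<alpha>"
    then show "{Low x, Low y} \<in> diagram n M \<otimes>\<^bsub>brauer n\<^esub> \<alpha>" by (rule product_low_low[OF d a])
  next
    fix x y assume xy: "{Up x, Low y} \<in> \<alpha>"
    then have "x \<notin> \<Union>M" using inM[OF _ xy] by auto
    then show "{Up x, Low y} \<in> diagram n M \<otimes>\<^bsub>brauer n\<^esub> \<alpha>"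
      using brauer_block_vertices[OF a xy] by (intro product_through[OF d a _ xy]) simp
  qed
qed

section \<open>Identity, monoid laws and projections\<close>

lemma perfect_matching_empty: "perfect_matching {} {}"
  by (simp add: perfect_matching_def partition_on_def)

lemma one_brauer: "\<one>\<^bsub>brauer n\<^esub> = diagram n {}"
  by (auto simp: brauer_def diagram_def)

lemma brauer_r_one:
  assumes a: "\<alpha> \<in> carrier (brauer n)"
  shows "\<alpha> \<otimes>\<^bsub>brauer n\<^esub> diagram n {} = \<alpha>"
proof -
  have d: "diagram n {} \<in> carrier (brauer n)" by (rule diagram_carrier[OF perfect_matching_empty]) simp
  show ?thesis
  proof (rule brauer_eqI[OF a brauer_closed[OF a d], symmetric])
    fix x y assume "{Up x, Up y} \<in> \<alpha>"
    then show "{Up x, Up y} \<in> \<alpha> \<otimes>\<^bsub>brauer n\<^esub> diagram n {}" by (rule product_up_up[OF a d])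
  next
    fix x y assume xy: "{Low x, Low y} \<in> \<alpha>"
    then show "{Low x, Low y} \<in> \<alpha> \<otimes>\<^bsub>brauer n\<^esub> diagram n {}"
      using brauer_block_vertices[OF a xy] by (intro product_cup[OF a d xy]) simp_all
  next
    fix x y assume xy: "{Up x, Low y} \<in> \<alpha>"
    then show "{Up x, Low y} \<in> \<alpha> \<otimes>\<^bsub>brauer n\<^esub> diagram n {}"
      using brauer_block_vertices[OF a xy] by (intro product_through[OF a d xy]) simp_all
  qed
qed

lemma monoid_brauer: "monoid (brauer n)"
proof (rule monoidI)
  show "\<one>\<^bsub>brauer n\<^esub> \<in> carrier (brauer n)"
    unfolding one_brauer by (rule diagram_carrier[OF perfect_matching_empty]) simp
  show "\<one>\<^bsub>brauer n\<^esub> \<otimes>\<^bsub>brauer n\<^esub> \<alpha> = \<alpha>" if "\<alpha> \<in> carrier (brauer n)" for \<alpha>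
    unfolding one_brauer by (rule diagram_mult_left[OF perfect_matching_empty _ that]) auto
qed (simp_all add: brauer_assoc one_brauer brauer_r_one)

lemma diagram_projection:
  assumes "perfect_matching W M" "W \<subseteq> {1..n}"
  shows "diagram n M \<in> projections n"
proof -
  have f: "flip ` Up ` X = Low ` X" "flip ` Low ` X = Up ` X" for X
    by (auto simp: image_image)
  have "star (diagram n M) = diagram n M"
    unfolding star_def diagram_def image_Un image_image by (simp add: f insert_commute Un_commute)
  then show ?thesis
    using diagram_carrier[OF assms] diagram_mult_left[OF assms diagram_carrier[OF assms]]
    by (simp add: projections_def)
qed

subsection \<open>Domain, codomain and rank\<close>

definition through_dom :: "vertex set set \<Rightarrow> nat set" where
  "through_dom \<alpha> = {x. \<exists>y. {Up x, Low y} \<in> \<alpha>}"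

definition through_cod :: "vertex set set \<Rightarrow> nat set" where
  "through_cod \<alpha> = {y. \<exists>x. {Up x, Low y} \<in> \<alpha>}"

lemma through_dom_subset: "\<alpha> \<in> carrier (brauer n) \<Longrightarrow> through_dom \<alpha> \<subseteq> {1..n}"
  using brauer_block_vertices by (fastforce simp: through_dom_def)

lemma through_cod_subset: "\<alpha> \<in> carrier (brauer n) \<Longrightarrow> through_cod \<alpha> \<subseteq> {1..n}"
  using brauer_block_vertices by (fastforce simp: through_cod_def)

lemma
  assumes a: "\<alpha> \<in> carrier (brauer n)"
  shows rank_eq_card_dom: "rank \<alpha> = card (through_dom \<alpha>)"
    and rank_eq_card_cod: "rank \<alpha> = card (through_cod \<alpha>)"
proof -
  define T where "T = {(x, y). {Up x, Low y} \<in> \<alpha>}"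
  have "{B \<in> \<alpha>. (\<exists>x. Up x \<in> B) \<and> (\<exists>y. Low y \<in> B)} = (\<lambda>(x, y). {Up x, Low y}) ` T"
  proof (intro equalityI subsetI)
    fix B assume "B \<in> {B \<in> \<alpha>. (\<exists>x. Up x \<in> B) \<and> (\<exists>y. Low y \<in> B)}"
    then obtain x y where xy: "B \<in> \<alpha>" "Up x \<in> B" "Low y \<in> B" by auto
    then have "B = {Up x, Low y}" by (intro perfect_matching_same_block[OF brauer_matching[OF a]]) auto
    then show "B \<in> (\<lambda>(x, y). {Up x, Low y}) ` T" using xy(1) by (auto simp: T_def)
  qed (auto simp: T_def)
  moreover have "inj_on (\<lambda>(x, y). {Up x, Low y}) T" by (auto simp: inj_on_def doubleton_eq_iff)
  ultimately have "rank \<alpha> = card T" by (simp add: rank_def card_image)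
  moreover have "through_dom \<alpha> = fst ` T" "through_cod \<alpha> = snd ` T"
    by (force simp: through_dom_def through_cod_def T_def)+
  moreover have "inj_on fst T"
    by (auto simp: inj_on_def T_def dest: brauer_unique[OF a])
  moreover have "inj_on snd T"
    by (auto simp: inj_on_def T_def dest: brauer_unique'[OF a])
  ultimately show "rank \<alpha> = card (through_dom \<alpha>)" "rank \<alpha> = card (through_cod \<alpha>)"
    by (simp_all add: card_image)
qed

lemma through_cod_diagram: "through_cod (diagram n M) = {1..n} - \<Union>M"
  by (auto simp: through_cod_def)

text \<open>Upper hooks of the left factor survive, so a point off the through lines of \<alpha>
  cannot be on one of the product.\<close>

lemma rank_mult_le:
  assumes a: "\<alpha> \<in> carrier (brauer n)" and b: "\<beta> \<in> carrier (brauer n)"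
  shows "rank (\<alpha> \<otimes>\<^bsub>brauer n\<^esub> \<beta>) \<le> rank \<alpha>"
proof -
  have "through_dom (\<alpha> \<otimes>\<^bsub>brauer n\<^esub> \<beta>) \<subseteq> through_dom \<alpha>"
  proof
    fix x assume "x \<in> through_dom (\<alpha> \<otimes>\<^bsub>brauer n\<^esub> \<beta>)"
    then obtain y where y: "{Up x, Low y} \<in> \<alpha> \<otimes>\<^bsub>brauer n\<^esub> \<beta>" by (auto simp: through_dom_def)
    then have "x \<in> {1..n}" using brauer_block_vertices[OF brauer_closed[OF a b]] by fastforce
    with a show "x \<in> through_dom \<alpha>"
    proof (cases rule: brauer_up_cases)
      case (upper z)
      then show ?thesis using brauer_unique[OF brauer_closed[OF a b] y product_up_up[OF a b]] by auto
    qed (auto simp: through_dom_def)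
  qed
  then show ?thesis
    unfolding rank_eq_card_dom[OF a] rank_eq_card_dom[OF brauer_closed[OF a b]]
    by (intro card_mono finite_subset[OF through_dom_subset[OF a]]) auto
qed

text \<open>Pairs of numbers rather than of vertices, so that the result can be passed to
  \<open>diagram\<close>.\<close>

definition lower_hooks :: "vertex set set \<Rightarrow> nat set set" where
  "lower_hooks \<alpha> = {X. Low ` X \<in> \<alpha>}"

lemma lower_hooks_doubleton [simp]: "{x, y} \<in> lower_hooks \<alpha> \<longleftrightarrow> {Low x, Low y} \<in> \<alpha>"
  by (simp add: lower_hooks_def)

lemma perfect_matching_vimage:
  assumes P: "perfect_matching V P" and f: "inj f"
  shows "perfect_matching (\<Union>{X. f ` X \<in> P}) {X. f ` X \<in> P}"
proof -
  have "card X = 2" if "f ` X \<in> P" for X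
    using that P card_image[OF inj_on_subset[OF f subset_UNIV], of X] by (simp add: perfect_matching_def)
  moreover have "X = Y" if "f ` X \<in> P" "f ` Y \<in> P" "x \<in> X" "x \<in> Y" for X Y x
  proof -
    have "f ` X = f ` Y" using that by (intro perfect_matching_block_unique[OF P, of _ _ "f x"]) auto
    then show ?thesis using inj_image_eq_iff[OF f] by blast
  qed
  moreover have "{} \<notin> P" using P by (auto simp: perfect_matching_def)
  ultimately show ?thesis
    by (auto simp: perfect_matching_def partition_on_def disjoint_def)
qed

lemma Union_lower_hooks:
  assumes a: "\<alpha> \<in> carrier (brauer n)"
  shows "\<Union>(lower_hooks \<alpha>) = {1..n} - through_cod \<alpha>"
proof (intro equalityI subsetI)
  fix x assume "x \<in> \<Union>(lower_hooks \<alpha>)"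
  then obtain X where X: "Low ` X \<in> \<alpha>" "x \<in> X" by (auto simp: lower_hooks_def)
  then have "x \<in> {1..n}" using perfect_matching_subset[OF brauer_matching[OF a] X(1)] by auto
  moreover have "x \<notin> through_cod \<alpha>"
  proof
    assume "x \<in> through_cod \<alpha>"
    then obtain y where "{Up y, Low x} \<in> \<alpha>" by (auto simp: through_cod_def)
    then have "Low ` X = {Up y, Low x}"
      using X by (intro perfect_matching_block_unique[OF brauer_matching[OF a], of _ _ "Low x"]) auto
    then show False using not_Low_image(1) by blast
  qed
  ultimately show "x \<in> {1..n} - through_cod \<alpha>" by blast
next
  fix x assume x: "x \<in> {1..n} - through_cod \<alpha>"
  then have "x \<in> {1..n}" by blast
  with a show "x \<in> \<Union>(lower_hooks \<alpha>)"
  proof (cases rule: brauer_low_cases)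
    case (lower y)
    then have "{x, y} \<in> lower_hooks \<alpha>" by simp
    then show ?thesis by blast
  next
    case (through y)
    then show ?thesis using x by (auto simp: through_cod_def)
  qed
qed

lemma lower_hooks_matching:
  assumes "\<alpha> \<in> carrier (brauer n)"
  shows "perfect_matching ({1..n} - through_cod \<alpha>) (lower_hooks \<alpha>)"
  using perfect_matching_vimage[OF brauer_matching[OF assms] inj_Low] Union_lower_hooks[OF assms]
  by (simp add: lower_hooks_def)

text \<open>The bottom points off the through lines are matched by the lower hooks, so
  \<open>n - rank \<alpha>\<close> is even. Consequently every diagram has a through line, and ranks
  up to 3 are 1 or 3.\<close>

lemma odd_rank:
  assumes "\<alpha> \<in> carrier (brauer n)" "odd n"
  shows "odd (rank \<alpha>)"
proof -
  have "even (card ({1..n} - through_cod \<alpha>))"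
    using perfect_matching_even[OF lower_hooks_matching[OF assms(1)]] by simp
  moreover have "card ({1..n} - through_cod \<alpha>) = n - rank \<alpha>" "rank \<alpha> \<le> n"
    using through_cod_subset[OF assms(1)] card_mono[OF _ through_cod_subset[OF assms(1)]]
    by (simp_all add: rank_eq_card_cod[OF assms(1)] card_Diff_subset finite_subset)
  ultimately show ?thesis using assms(2) by auto
qed

section \<open>The right congruence\<close>

text \<open>The index set starts at 1 for the hooks of \<zeta> and at 2 for those of the rank 3
  projection.\<close>

definition pairs :: "nat set \<Rightarrow> nat set set" where
  "pairs J = (\<lambda>i. {2 * i, 2 * i + 1}) ` J"

lemma pairs_iff: "{x, y} \<in> pairs J \<longleftrightarrow> (\<exists>i\<in>J. x = 2 * i \<and> y = 2 * i + 1 \<or> x = 2 * i + 1 \<and> y = 2 * i)"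
  by (auto simp: pairs_def doubleton_eq_iff image_iff)

lemma pairs_matching: "perfect_matching (\<Union>(pairs J)) (pairs J)"
proof -
  have "i = j" if "x \<in> {2 * i, 2 * i + 1}" "x \<in> {2 * j, 2 * j + 1}" for i j x :: nat
    using that by auto
  then have "disjoint (pairs J)" unfolding pairs_def disjoint_def by blast
  then show ?thesis by (auto simp: perfect_matching_def partition_on_def pairs_def)
qed

lemma Union_pairs_from:
  assumes "odd n"
  shows "\<Union>(pairs {k..(n - 1) div 2}) = {2 * k..n}"
proof (intro equalityI subsetI)
  fix x assume "x \<in> {2 * k..n}"
  then have "x div 2 \<in> {k..(n - 1) div 2}" "x = 2 * (x div 2) \<or> x = 2 * (x div 2) + 1"
    using assms by (auto elim!: oddE)
  then show "x \<in> \<Union>(pairs {k..(n - 1) div 2})" unfolding pairs_def by blast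
qed (use assms in \<open>auto simp: pairs_def elim!: oddE\<close>)

lemma Union_pairs: "odd n \<Longrightarrow> \<Union>(pairs {1..(n - 1) div 2}) = {2..n}"
  using Union_pairs_from[of n 1] by simp

lemma pairs_subset:
  assumes "odd n" "J \<subseteq> {1..(n - 1) div 2}"
  shows "\<Union>(pairs J) \<subseteq> {1..n}"
proof -
  have "\<Union>(pairs J) \<subseteq> \<Union>(pairs {1..(n - 1) div 2})" using assms(2) unfolding pairs_def by blast
  then show ?thesis using Union_pairs[OF assms(1)] by auto
qed

abbreviation zeta_pairs :: "nat \<Rightarrow> nat set set" where
  "zeta_pairs n \<equiv> pairs {1..(n - 1) div 2}"

lemma zeta_eq:
  assumes "odd n"
  shows "zeta n = diagram n (zeta_pairs n)"
proof -
  have "{1..n} - {2..n} = {1}" using odd_pos[OF assms] by auto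
  moreover have "(\<Union>i\<in>J. {{Up (2*i), Up (2*i + 1)}, {Low (2*i), Low (2*i + 1)}}) =
      (`) Up ` pairs J \<union> (`) Low ` pairs J" for J
    by (auto simp: pairs_def image_image)
  ultimately show ?thesis
    unfolding zeta_def diagram_def Union_pairs[OF assms] by simp
qed

lemma one_not_paired: "{1, y} \<notin> zeta_pairs n"
  by (auto simp: pairs_iff)

lemma zeta_carrier: "odd n \<Longrightarrow> zeta n \<in> carrier (brauer n)"
  unfolding zeta_eq by (intro diagram_carrier[OF pairs_matching] pairs_subset) auto

text \<open>The relation \<open>ker\<close> contains the diagonal of \<open>{1..n}\<close> for every
  diagram, so the inclusion of kernels only constrains genuine hooks.\<close>

lemma K_iff:
  assumes "odd n"
  shows "\<alpha> \<in> K n \<longleftrightarrow>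
    \<alpha> \<in> carrier (brauer n) \<and> (\<forall>x y. {Up x, Up y} \<in> \<alpha> \<longrightarrow> {x, y} \<in> zeta_pairs n)"
proof (cases "\<alpha> \<in> carrier (brauer n)")
  case a: True
  note z = zeta_carrier[OF assms]
  have "ker \<alpha> \<subseteq> ker (zeta n)" if *: "\<forall>x y. {Up x, Up y} \<in> \<alpha> \<longrightarrow> {x, y} \<in> zeta_pairs n"
  proof
    fix p assume "p \<in> ker \<alpha>"
    then obtain x y B where p: "p = (x, y)" "B \<in> \<alpha>" "Up x \<in> B" "Up y \<in> B" by (auto simp: ker_def)
    show "p \<in> ker (zeta n)"
    proof (cases "x = y")
      case True
      have "Up x \<in> vertices n" using perfect_matching_subset[OF brauer_matching[OF a] p(2)] p(3) by blast
      then obtain C where "C \<in> zeta n" "Up x \<in> C"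
        using perfect_matching_Union[OF brauer_matching[OF z]] by blast
      then show ?thesis using p(1) True by (auto simp: ker_def)
    next
      case False
      then have "B = {Up x, Up y}"
        using p by (intro perfect_matching_same_block[OF brauer_matching[OF a]]) auto
      then have "{Up x, Up y} \<in> zeta n" using * p(2) by (simp add: zeta_eq[OF assms])
      then show ?thesis using p(1) by (auto simp: ker_def)
    qed
  qed
  moreover have "{x, y} \<in> zeta_pairs n" if k: "ker \<alpha> \<subseteq> ker (zeta n)" and xy: "{Up x, Up y} \<in> \<alpha>" for x y
  proof -
    have "(x, y) \<in> ker \<alpha>" using xy by (auto simp: ker_def)
    then obtain B where B: "B \<in> zeta n" "Up x \<in> B" "Up y \<in> B" using k by (auto simp: ker_def)
    have "B = {Up x, Up y}"
      using brauer_block_vertices[OF a xy]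
      by (intro perfect_matching_same_block[OF brauer_matching[OF z] B]) auto
    then show ?thesis using B(1) by (simp add: zeta_eq[OF assms])
  qed
  ultimately show ?thesis using a unfolding K_def by blast
qed (simp add: K_def)

lemma K_carrier: "\<alpha> \<in> K n \<Longrightarrow> \<alpha> \<in> carrier (brauer n)"
  by (simp add: K_def)

lemma I_carrier: "\<alpha> \<in> I n \<Longrightarrow> \<alpha> \<in> carrier (brauer n)"
  by (simp add: I_def)

text \<open>No hook of \<zeta> covers 1. This makes the partner of 1 available as an invariant on
  \<open>K\<close>.\<close>

lemma K_one_through:
  assumes "odd n" "\<alpha> \<in> K n"
  obtains d where "{Up 1, Low d} \<in> \<alpha>"
proof -
  have "1 \<in> {1..n}" using odd_pos[OF assms(1)] by simp
  with K_carrier[OF assms(2)] show thesis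
  proof (cases rule: brauer_up_cases)
    case (upper y)
    then have "{1, y} \<in> zeta_pairs n" using assms unfolding K_iff[OF assms(1)] by blast
    then show ?thesis using one_not_paired by blast
  qed (rule that)
qed

lemma I_mult:
  assumes "odd n" "\<alpha> \<in> I n" "\<beta> \<in> carrier (brauer n)"
  shows "\<alpha> \<otimes>\<^bsub>brauer n\<^esub> \<beta> \<in> I n"
proof -
  have a: "\<alpha> \<in> carrier (brauer n)" by (rule I_carrier[OF assms(2)])
  then obtain x y where "{Up x, Up y} \<in> \<alpha>" "{x, y} \<notin> zeta_pairs n"
    using assms(1,2) by (auto simp: I_def K_iff)
  then show ?thesis
    using product_up_up[OF a assms(3)] brauer_closed[OF a assms(3)] assms(1) by (auto simp: I_def K_iff)
qed

subsection \<open>The group \<open>U\<close>\<close>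

text \<open>A hook would survive in the product with the inverse, on the left or on the right, but
  the identity has none.\<close>

lemma Units_no_hooks:
  assumes "u \<in> Units (brauer n)"
  shows "{Up x, Up y} \<notin> u" "{Low x, Low y} \<notin> u"
proof -
  obtain v where v: "v \<in> carrier (brauer n)" "u \<otimes>\<^bsub>brauer n\<^esub> v = diagram n {}"
      "v \<otimes>\<^bsub>brauer n\<^esub> u = diagram n {}" and u: "u \<in> carrier (brauer n)"
    using assms by (auto simp: Units_def one_brauer)
  show "{Up x, Up y} \<notin> u"
    using product_up_up[OF u v(1), of x y] v(2) by auto
  show "{Low x, Low y} \<notin> u"
    using product_low_low[OF v(1) u, of x y] v(3) by auto
qed

lemma Units_carrier: "u \<in> Units (brauer n) \<Longrightarrow> u \<in> carrier (brauer n)"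
  by (simp add: Units_def)

lemma Units_through:
  assumes u: "u \<in> Units (brauer n)" and x: "x \<in> {1..n}"
  obtains y where "{Up x, Low y} \<in> u"
  using Units_carrier[OF u] x
  by (cases rule: brauer_up_cases) (use Units_no_hooks[OF u] in auto)

lemma Units_through':
  assumes u: "u \<in> Units (brauer n)" and y: "y \<in> {1..n}"
  obtains x where "{Up x, Low y} \<in> u"
  using Units_carrier[OF u] y
  by (cases rule: brauer_low_cases) (use Units_no_hooks[OF u] in auto)

lemma U_Units: "u \<in> U n \<Longrightarrow> u \<in> Units (brauer n)"
  by (simp add: U_def)

lemma U_carrier: "u \<in> U n \<Longrightarrow> u \<in> carrier (brauer n)"
  by (simp add: U_def Units_def)

lemma U_one:
  assumes "odd n"
  shows "\<one>\<^bsub>brauer n\<^esub> \<in> U n"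
  using monoid.Units_one_closed[OF monoid_brauer] monoid.l_one[OF monoid_brauer zeta_carrier[OF assms]]
  by (simp add: U_def)

lemma U_mult:
  assumes "odd n" "u \<in> U n" "v \<in> U n"
  shows "u \<otimes>\<^bsub>brauer n\<^esub> v \<in> U n"
  using assms monoid.Units_m_closed[OF monoid_brauer, of u n v]
    brauer_assoc[OF U_carrier U_carrier zeta_carrier, of u n v]
  by (simp add: U_def)

lemma U_inverse:
  assumes "odd n" "u \<in> U n"
  obtains v where "v \<in> U n" "u \<otimes>\<^bsub>brauer n\<^esub> v = \<one>\<^bsub>brauer n\<^esub>" "v \<otimes>\<^bsub>brauer n\<^esub> u = \<one>\<^bsub>brauer n\<^esub>"
proof -
  note u = U_carrier[OF assms(2)] and z = zeta_carrier[OF assms(1)]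
  obtain v where v: "v \<in> carrier (brauer n)" "u \<otimes>\<^bsub>brauer n\<^esub> v = \<one>\<^bsub>brauer n\<^esub>"
      "v \<otimes>\<^bsub>brauer n\<^esub> u = \<one>\<^bsub>brauer n\<^esub>"
    using assms(2) by (auto simp: U_def Units_def)
  have "v \<otimes>\<^bsub>brauer n\<^esub> zeta n = v \<otimes>\<^bsub>brauer n\<^esub> (u \<otimes>\<^bsub>brauer n\<^esub> zeta n)"
    using assms(2) by (simp add: U_def)
  also have "\<dots> = zeta n"
    using brauer_assoc[OF v(1) u z] v(3) monoid.l_one[OF monoid_brauer z] by simp
  finally have "v \<in> U n" using u v by (auto simp: U_def Units_def)
  then show thesis using that v by blast
qed

text \<open>If \<open>u\<close> sent 1 to another point, the hook of \<zeta> there would be pulled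
  back through \<open>u\<close> to a hook at 1 in the product of \<open>u\<close> and \<zeta>, which
  is \<zeta> itself.\<close>

lemma U_fixes_one:
  assumes "odd n" "u \<in> U n"
  shows "{Up 1, Low 1} \<in> u"
proof -
  note u = U_carrier[OF assms(2)] and z = zeta_carrier[OF assms(1)]
  have uz: "u \<otimes>\<^bsub>brauer n\<^esub> zeta n = zeta n" using assms(2) by (simp add: U_def)
  have one: "1 \<in> {1..n}" using odd_pos[OF assms(1)] by simp
  obtain a where a: "{Up 1, Low a} \<in> u" using Units_through[OF U_Units[OF assms(2)] one] .
  then have "a \<in> {1..n}" using brauer_block_vertices[OF u a] by simp
  with z have "a = 1"
  proof (cases rule: brauer_up_cases)
    case (upper b)
    then have "b \<in> {1..n}" using brauer_block_vertices[OF z upper] by simp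
    then obtain c where "{Up c, Low b} \<in> u" using Units_through'[OF U_Units[OF assms(2)]] by metis
    then have "{Up 1, Up c} \<in> zeta n" using product_cap[OF u z a _ upper] uz by simp
    then have "{1, c} \<in> zeta_pairs n" unfolding zeta_eq[OF assms(1)] diagram_upper .
    then show ?thesis using one_not_paired by blast
  next
    case (through y)
    then have "a \<in> {1..n} - {2..n}"
      unfolding zeta_eq[OF assms(1)] diagram_through Union_pairs[OF assms(1)] by blast
    then show ?thesis by auto
  qed
  then show ?thesis using a by simp
qed

text \<open>A unit only relabels upper hooks. A hook of the product comes from a hook of \<alpha>,
  which is one of \<zeta>; pulling the latter back through \<open>u\<close> gives a hook of \<zeta>
  again, since \<open>u\<close> stabilises \<zeta>.\<close>

lemma U_mult_K:
  assumes "odd n" "u \<in> U n" "\<alpha> \<in> K n"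
  shows "u \<otimes>\<^bsub>brauer n\<^esub> \<alpha> \<in> K n"
proof -
  note u = U_carrier[OF assms(2)] and z = zeta_carrier[OF assms(1)] and a = K_carrier[OF assms(3)]
  note ua = brauer_closed[OF u a]
  have uz: "u \<otimes>\<^bsub>brauer n\<^esub> zeta n = zeta n" using assms(2) by (simp add: U_def)
  have "{x, y} \<in> zeta_pairs n" if xy: "{Up x, Up y} \<in> u \<otimes>\<^bsub>brauer n\<^esub> \<alpha>" for x y
  proof -
    have x: "x \<in> {1..n}" and y: "y \<in> {1..n}" using brauer_block_vertices[OF ua xy] by simp_all
    obtain b where b: "{Up x, Low b} \<in> u" using Units_through[OF U_Units[OF assms(2)] x] .
    obtain c where c: "{Up y, Low c} \<in> u" using Units_through[OF U_Units[OF assms(2)] y] .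
    have "b \<in> {1..n}" using brauer_block_vertices[OF u b] by simp
    with a have "{Up b, Up c} \<in> \<alpha>"
    proof (cases rule: brauer_up_cases)
      case (upper d)
      then have "d \<in> {1..n}" using brauer_block_vertices[OF a upper] by simp
      then obtain w where w: "{Up w, Low d} \<in> u" using Units_through'[OF U_Units[OF assms(2)]] by metis
      then have "Up w = Up y" using brauer_unique[OF ua product_cap[OF u a b w upper] xy] by simp
      then have "c = d" using brauer_unique[OF u c, of "Low d"] w by simp
      then show ?thesis using upper by simp
    next
      case (through d)
      then show ?thesis using brauer_unique[OF ua xy product_through[OF u a b through]] by simp
    qed
    then have "{Up b, Up c} \<in> zeta n" using assms(1,3) by (simp add: K_iff zeta_eq)
    then have "{Up x, Up y} \<in> zeta n" using product_cap[OF u z b c] uz by simp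
    then show ?thesis using assms(1) by (simp add: zeta_eq)
  qed
  then show ?thesis using ua assms(1) by (simp add: K_iff)
qed

subsection \<open>Classes of the right congruence\<close>

lemma in_U_coset: "\<beta> \<in> U n #>\<^bsub>brauer n\<^esub> \<alpha> \<longleftrightarrow> (\<exists>u\<in>U n. \<beta> = u \<otimes>\<^bsub>brauer n\<^esub> \<alpha>)"
  by (auto simp: r_coset_def)

lemma U_coset_self:
  assumes "odd n" "\<alpha> \<in> carrier (brauer n)"
  shows "\<alpha> \<in> U n #>\<^bsub>brauer n\<^esub> \<alpha>"
  using U_one[OF assms(1)] monoid.l_one[OF monoid_brauer assms(2)] unfolding in_U_coset by metis

lemma U_coset_absorb:
  assumes "odd n" "\<alpha> \<in> carrier (brauer n)" "u \<in> U n"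
  shows "U n #>\<^bsub>brauer n\<^esub> (u \<otimes>\<^bsub>brauer n\<^esub> \<alpha>) = U n #>\<^bsub>brauer n\<^esub> \<alpha>"
proof (intro equalityI subsetI)
  note u = U_carrier[OF assms(3)]
  fix \<beta> assume "\<beta> \<in> U n #>\<^bsub>brauer n\<^esub> (u \<otimes>\<^bsub>brauer n\<^esub> \<alpha>)"
  then obtain w where w: "w \<in> U n" "\<beta> = w \<otimes>\<^bsub>brauer n\<^esub> (u \<otimes>\<^bsub>brauer n\<^esub> \<alpha>)" by (auto simp: in_U_coset)
  then have "\<beta> = (w \<otimes>\<^bsub>brauer n\<^esub> u) \<otimes>\<^bsub>brauer n\<^esub> \<alpha>"
    using brauer_assoc[OF U_carrier[OF w(1)] u assms(2)] by simp
  then show "\<beta> \<in> U n #>\<^bsub>brauer n\<^esub> \<alpha>" using U_mult[OF assms(1) w(1) assms(3)] by (auto simp: in_U_coset)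
next
  note u = U_carrier[OF assms(3)]
  fix \<beta> assume "\<beta> \<in> U n #>\<^bsub>brauer n\<^esub> \<alpha>"
  then obtain w where w: "w \<in> U n" "\<beta> = w \<otimes>\<^bsub>brauer n\<^esub> \<alpha>" by (auto simp: in_U_coset)
  obtain v where v: "v \<in> U n" "v \<otimes>\<^bsub>brauer n\<^esub> u = \<one>\<^bsub>brauer n\<^esub>" using U_inverse[OF assms(1,3)] by metis
  have "(w \<otimes>\<^bsub>brauer n\<^esub> v) \<otimes>\<^bsub>brauer n\<^esub> (u \<otimes>\<^bsub>brauer n\<^esub> \<alpha>) = \<beta>"
    using brauer_assoc[OF U_carrier[OF w(1)] U_carrier[OF v(1)] brauer_closed[OF u assms(2)]]
      brauer_assoc[OF U_carrier[OF v(1)] u assms(2)] v(2) w(2)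
      monoid.l_one[OF monoid_brauer assms(2)] by simp
  then show "\<beta> \<in> U n #>\<^bsub>brauer n\<^esub> (u \<otimes>\<^bsub>brauer n\<^esub> \<alpha>)"
    using U_mult[OF assms(1) w(1) v(1)] by (auto simp: in_U_coset)
qed

lemma sigma_U:
  assumes "odd n" "\<alpha> \<in> K n" "u \<in> U n"
  shows "(\<alpha>, u \<otimes>\<^bsub>brauer n\<^esub> \<alpha>) \<in> sigma n"
  using assms U_coset_absorb[OF assms(1) K_carrier[OF assms(2)] assms(3)] U_mult_K[OF assms(1,3,2)]
  by (auto simp: sigma_def K_def)

lemma sigma_K_iff:
  assumes "odd n" "\<alpha> \<in> K n"
  shows "(\<alpha>, \<beta>) \<in> sigma n \<longleftrightarrow> (\<exists>u\<in>U n. \<beta> = u \<otimes>\<^bsub>brauer n\<^esub> \<alpha>)"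
proof
  assume *: "(\<alpha>, \<beta>) \<in> sigma n"
  then have "\<beta> \<in> carrier (brauer n)" "U n #>\<^bsub>brauer n\<^esub> \<alpha> = U n #>\<^bsub>brauer n\<^esub> \<beta>"
    using assms(2) by (auto simp: sigma_def I_def)
  then have "\<beta> \<in> U n #>\<^bsub>brauer n\<^esub> \<alpha>" using U_coset_self[OF assms(1), of \<beta>] by simp
  then show "\<exists>u\<in>U n. \<beta> = u \<otimes>\<^bsub>brauer n\<^esub> \<alpha>" by (simp only: in_U_coset)
qed (use sigma_U[OF assms] in auto)

lemma sigma_K:
  assumes "(\<alpha>, \<beta>) \<in> sigma n"
  shows "\<alpha> \<in> K n \<longleftrightarrow> \<beta> \<in> K n"
  using assms by (auto simp: sigma_def I_def)

lemma sigma_I: "\<alpha> \<in> I n \<Longrightarrow> \<beta> \<in> I n \<Longrightarrow> (\<alpha>, \<beta>) \<in> sigma n"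
  by (simp add: sigma_def I_def)

lemma sigma_K_D:
  assumes "odd n" "(\<alpha>, \<beta>) \<in> sigma n" "\<alpha> \<in> K n"
  shows "{Up 1, Low d} \<in> \<alpha> \<Longrightarrow> {Up 1, Low d} \<in> \<beta>"
    and "{Low x, Low y} \<in> \<alpha> \<Longrightarrow> {Low x, Low y} \<in> \<beta>"
proof -
  note a = K_carrier[OF assms(3)]
  obtain u where u: "u \<in> U n" "\<beta> = u \<otimes>\<^bsub>brauer n\<^esub> \<alpha>"
    using assms(2) sigma_K_iff[OF assms(1,3)] by blast
  show "{Up 1, Low d} \<in> \<alpha> \<Longrightarrow> {Up 1, Low d} \<in> \<beta>"
    unfolding u(2) by (rule product_through[OF U_carrier[OF u(1)] a U_fixes_one[OF assms(1) u(1)]])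
  show "{Low x, Low y} \<in> \<alpha> \<Longrightarrow> {Low x, Low y} \<in> \<beta>"
    unfolding u(2) by (rule product_low_low[OF U_carrier[OF u(1)] a])
qed

lemma equiv_sigma: "equiv (carrier (brauer n)) (sigma n)"
  by (rule equivI) (auto simp: sigma_def I_def refl_on_def sym_def trans_def)

lemma right_congruence_sigma:
  assumes "odd n"
  shows "right_congruence (brauer n) (sigma n)"
  unfolding right_congruence_def
proof (intro conjI allI ballI impI equiv_sigma)
  fix \<alpha> \<beta> \<theta> assume ab: "(\<alpha>, \<beta>) \<in> sigma n" and t: "\<theta> \<in> carrier (brauer n)"
  then have a: "\<alpha> \<in> carrier (brauer n)" and b: "\<beta> \<in> carrier (brauer n)" by (auto simp: sigma_def)
  note at = brauer_closed[OF a t] and bt = brauer_closed[OF b t]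
  consider "\<alpha> \<in> I n" "\<beta> \<in> I n" | u where "u \<in> U n" "\<beta> = u \<otimes>\<^bsub>brauer n\<^esub> \<alpha>"
    using ab sigma_K_iff[OF assms, of \<alpha> \<beta>] by (auto simp: sigma_def)
  then show "(\<alpha> \<otimes>\<^bsub>brauer n\<^esub> \<theta>, \<beta> \<otimes>\<^bsub>brauer n\<^esub> \<theta>) \<in> sigma n"
  proof cases
    case 1
    then show ?thesis by (intro sigma_I I_mult assms t)
  next
    case 2
    then have bt': "\<beta> \<otimes>\<^bsub>brauer n\<^esub> \<theta> = u \<otimes>\<^bsub>brauer n\<^esub> (\<alpha> \<otimes>\<^bsub>brauer n\<^esub> \<theta>)"
      using brauer_assoc[OF U_carrier[OF 2(1)] a t] by simp
    show ?thesis
    proof (cases "\<alpha> \<otimes>\<^bsub>brauer n\<^esub> \<theta> \<in> K n")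
      case True
      then show ?thesis unfolding bt' by (rule sigma_U[OF assms _ 2(1)])
    next
      \<comment> \<open>The inverse \<open>v\<close> carries the second product back to the first,
        so by \<open>U_mult_K\<close> the two can only leave \<open>K\<close> together.\<close>
      case False
      obtain v where v: "v \<in> U n" "v \<otimes>\<^bsub>brauer n\<^esub> u = \<one>\<^bsub>brauer n\<^esub>" using U_inverse[OF assms 2(1)] by metis
      have "v \<otimes>\<^bsub>brauer n\<^esub> (\<beta> \<otimes>\<^bsub>brauer n\<^esub> \<theta>) = \<alpha> \<otimes>\<^bsub>brauer n\<^esub> \<theta>"
        unfolding bt' using brauer_assoc[OF U_carrier[OF v(1)] U_carrier[OF 2(1)] at] v(2)
          monoid.l_one[OF monoid_brauer at] by simp
      then have "\<beta> \<otimes>\<^bsub>brauer n\<^esub> \<theta> \<notin> K n" using U_mult_K[OF assms v(1)] False by metis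
      then show ?thesis using False at bt by (intro sigma_I) (simp_all add: I_def)
    qed
  qed
qed

section \<open>Faithfulness\<close>

abbreviation eps_pairs :: "nat \<Rightarrow> nat set set" where
  "eps_pairs n \<equiv> pairs {2..(n - 1) div 2}"

lemma zeta_pairs_iff:
  assumes "odd n" "n \<ge> 3"
  shows "{x, y} \<in> zeta_pairs n \<longleftrightarrow> {x, y} = {2, 3} \<or> {x, y} \<in> eps_pairs n"
proof -
  have "{1..(n - 1) div 2} = insert 1 {2..(n - 1) div 2}" using assms by (auto elim!: oddE)
  then have "zeta_pairs n = insert {2, 3} (eps_pairs n)" by (simp add: pairs_def)
  then show ?thesis by auto
qed

lemma Union_eps_pairs: "odd n \<Longrightarrow> \<Union>(eps_pairs n) = {4..n}"
  using Union_pairs_from[of n 2] by simp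

lemma eps_pairs_ge:
  assumes "odd n" "{x, y} \<in> eps_pairs n"
  shows "x \<in> {4..n}" "y \<in> {4..n}"
  using assms(2) Union_eps_pairs[OF assms(1)] by blast+

text \<open>
  The hooked diagrams are those of the form \<open>\<epsilon>\<alpha>\<close>, where \<open>\<epsilon>\<close> is the projection of rank 3
  obtained from \<open>\<zeta>\<close> by replacing the hooks on 2 and 3 by vertical lines.
\<close>

definition hooked :: "nat \<Rightarrow> vertex set set \<Rightarrow> bool" where
  "hooked n \<alpha> \<longleftrightarrow> \<alpha> \<in> carrier (brauer n) \<and> (\<forall>x y. {x, y} \<in> eps_pairs n \<longrightarrow> {Up x, Up y} \<in> \<alpha>)"

definition eps :: "nat \<Rightarrow> vertex set set" where
  "eps n = diagram n (eps_pairs n)"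

lemma eps_pairs_matching: "odd n \<Longrightarrow> perfect_matching {4..n} (eps_pairs n)"
  by (metis pairs_matching Union_eps_pairs)

lemma eps_carrier: "odd n \<Longrightarrow> eps n \<in> carrier (brauer n)"
  unfolding eps_def by (rule diagram_carrier[OF eps_pairs_matching]) auto

lemma hooked_eps: "odd n \<Longrightarrow> hooked n (eps n)"
  using eps_carrier by (simp add: hooked_def) (simp add: eps_def)

lemma hooked_carrier: "hooked n \<alpha> \<Longrightarrow> \<alpha> \<in> carrier (brauer n)"
  by (simp add: hooked_def)

lemma hookedD: "hooked n \<alpha> \<Longrightarrow> {x, y} \<in> eps_pairs n \<Longrightarrow> {Up x, Up y} \<in> \<alpha>"
  by (simp add: hooked_def)

lemma hooked_mult: "hooked n \<alpha> \<Longrightarrow> \<beta> \<in> carrier (brauer n) \<Longrightarrow> hooked n (\<alpha> \<otimes>\<^bsub>brauer n\<^esub> \<beta>)"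
  by (auto simp: hooked_def intro: product_up_up)

lemma eps_mult_hooked:
  assumes "odd n" "hooked n \<alpha>"
  shows "eps n \<otimes>\<^bsub>brauer n\<^esub> \<alpha> = \<alpha>"
  unfolding eps_def
  by (rule diagram_mult_left[OF eps_pairs_matching[OF assms(1)] _ hooked_carrier[OF assms(2)] hookedD[OF assms(2)]])
    auto

lemma hooked_up:
  assumes "odd n" "hooked n \<alpha>" "{Up x, v} \<in> \<alpha>" "x \<ge> 4"
  obtains y where "v = Up y" "{x, y} \<in> eps_pairs n"
proof -
  note a = hooked_carrier[OF assms(2)]
  have "x \<in> {4..n}" using brauer_block_vertices[OF a assms(3)] assms(4) by simp
  then obtain y where y: "{x, y} \<in> eps_pairs n"
    using perfect_matching_partner[OF eps_pairs_matching[OF assms(1)]] by metis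
  then show thesis using that brauer_unique[OF a assms(3) hookedD[OF assms(2) y]] by blast
qed

lemma hooked_through:
  assumes "odd n" "hooked n \<alpha>" "{Up x, Low y} \<in> \<alpha>"
  shows "x = 1 \<or> x = 2 \<or> x = 3"
proof (rule ccontr)
  assume "\<not> ?thesis"
  moreover have "x \<ge> 1" using brauer_block_vertices[OF hooked_carrier[OF assms(2)] assms(3)] by simp
  ultimately have "x \<ge> 4" by auto
  then show False using hooked_up[OF assms] by (metis vertex.distinct(3))
qed

lemma hooked_rank:
  assumes "odd n" "hooked n \<alpha>"
  shows "rank \<alpha> \<le> 3"
proof -
  have "through_dom \<alpha> \<subseteq> {1, 2, 3}" using hooked_through[OF assms] by (auto simp: through_dom_def)
  then have "card (through_dom \<alpha>) \<le> card {1, 2, 3 :: nat}" by (intro card_mono) auto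
  then show ?thesis using rank_eq_card_dom[OF hooked_carrier[OF assms(2)]] by simp
qed

text \<open>The points from 4 on carry hooks of \<zeta>. Once 1 is on a line, the only other
  possible upper hook is 2-3, also one of \<zeta>. Thus for hooked diagrams the partner of 1 decides
  between \<open>K\<close> and \<open>I\<close>.\<close>

lemma hooked_K:
  assumes n: "odd n" "n \<ge> 3" and h: "hooked n \<alpha>" and s: "{Up 1, Low s} \<in> \<alpha>"
  shows "\<alpha> \<in> K n"
  unfolding K_iff[OF n(1)]
proof (intro conjI allI impI)
  note a = hooked_carrier[OF h]
  show "\<alpha> \<in> carrier (brauer n)" by (rule a)
  fix x y assume xy: "{Up x, Up y} \<in> \<alpha>"
  then have yx: "{Up y, Up x} \<in> \<alpha>" by (simp add: insert_commute)
  have pos: "x \<noteq> y" "x \<ge> 1" "y \<ge> 1" using brauer_block_vertices[OF a xy] by auto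
  have not1: "x \<noteq> 1" "y \<noteq> 1" using brauer_unique[OF a s] xy yx by auto
  have "{x, y} = {2, 3} \<or> {x, y} \<in> eps_pairs n"
  proof (cases "x \<ge> 4 \<or> y \<ge> 4")
    case True
    then show ?thesis
    proof
      assume "x \<ge> 4"
      then show ?thesis using hooked_up[OF n(1) h xy] by (metis vertex.inject(1))
    next
      assume "y \<ge> 4"
      then show ?thesis using hooked_up[OF n(1) h yx] by (metis vertex.inject(1) insert_commute)
    qed
  next
    case False
    then have "x = 2 \<and> y = 3 \<or> x = 3 \<and> y = 2" using pos not1 by linarith
    then show ?thesis by auto
  qed
  then show "{x, y} \<in> zeta_pairs n" using zeta_pairs_iff[OF n] by blast
qed

text \<open>The prescribed blocks are disjoint and use up the whole upper row; the remaining bottom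
  points are matched arbitrarily, which parity allows. \<open>L\<close> serves to force one further
  lower hook.\<close>

lemma connector_exists:
  assumes n: "odd n" "n \<ge> 3"
    and xyz: "x \<in> {1..n}" "y \<in> {1..n}" "z \<in> {1..n}" "x \<noteq> y" "x \<noteq> z" "y \<noteq> z"
    and L: "perfect_matching W L" "W \<subseteq> {1..n} - {x, y, z}"
  obtains \<gamma> where "hooked n \<gamma>" "{Up 1, Low x} \<in> \<gamma>" "{Up 2, Low y} \<in> \<gamma>" "{Up 3, Low z} \<in> \<gamma>"
    "\<And>a b. {a, b} \<in> L \<Longrightarrow> {Low a, Low b} \<in> \<gamma>"
proof -
  let ?T = "{{Up 1, Low x}, {Up 2, Low y}, {Up 3, Low z}}"
  let ?P = "?T \<union> (`) Up ` eps_pairs n \<union> (`) Low ` L"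
  have "perfect_matching (\<Union>?T) ?T"
    using xyz by (auto simp: perfect_matching_def partition_on_def disjoint_def)
  then have "perfect_matching (\<Union>?T \<union> Up ` {4..n} \<union> Low ` W) ?P"
    using L(2) by (intro perfect_matching_Un perfect_matching_image L(1) eps_pairs_matching n
        inj_on_subset[OF inj_Up subset_UNIV] inj_on_subset[OF inj_Low subset_UNIV]) auto
  moreover have "\<Union>?T \<union> Up ` {4..n} \<union> Low ` W \<subseteq> vertices n"
    using xyz n L(2) by (auto simp: vertices_def)
  moreover have "even (card (vertices n))"
    using perfect_matching_even[OF brauer_matching[OF zeta_carrier[OF n(1)]]] by simp
  ultimately obtain \<gamma> where g: "perfect_matching (vertices n) \<gamma>" "?P \<subseteq> \<gamma>"
    using perfect_matching_extend finite_vertices by metis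
  show thesis
  proof (rule that)
    have "{Up a, Up b} \<in> (`) Up ` eps_pairs n" if "{a, b} \<in> eps_pairs n" for a b
      using imageI[OF that, of "(`) Up"] by simp
    then show "hooked n \<gamma>" using g unfolding hooked_def carrier_brauer by blast
    show "{Low a, Low b} \<in> \<gamma>" if "{a, b} \<in> L" for a b
      using imageI[OF that, of "(`) Low"] g(2) by auto
  qed (use g(2) in auto)
qed

lemma third_point:
  assumes "n \<ge> 3"
  obtains c :: nat where "c \<in> {1..n}" "c \<noteq> x" "c \<noteq> y"
proof -
  have "card {x, y} \<le> 2" by (simp add: card_insert_if)
  then have "\<not> {1..n} \<subseteq> {x, y}" using assms card_mono[of "{x, y}" "{1..n}"] by auto
  then show thesis using that by blast
qed

lemma through_exists:
  assumes "odd n" "\<alpha> \<in> carrier (brauer n)"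
  obtains x y where "{Up x, Low y} \<in> \<alpha>"
proof -
  have "card (through_dom \<alpha>) \<noteq> 0"
    using odd_rank[OF assms(2,1)] rank_eq_card_dom[OF assms(2)] by (metis even_zero)
  then have "through_dom \<alpha> \<noteq> {}" by (metis card.empty)
  then show thesis using that by (auto simp: through_dom_def)
qed

text \<open>Tests only with hooked multipliers. Their classes lie in \<Omega>
  (\<open>hooked_Omega\<close>), so equal action on \<Omega> implies this relation.\<close>

definition same_action :: "nat \<Rightarrow> vertex set set \<Rightarrow> vertex set set \<Rightarrow> bool" where
  "same_action n \<alpha> \<beta> \<longleftrightarrow> \<alpha> \<in> carrier (brauer n) \<and> \<beta> \<in> carrier (brauer n) \<and>
     (\<forall>\<gamma>. hooked n \<gamma> \<longrightarrow> (\<gamma> \<otimes>\<^bsub>brauer n\<^esub> \<alpha>, \<gamma> \<otimes>\<^bsub>brauer n\<^esub> \<beta>) \<in> sigma n)"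

lemma sigma_sym: "(\<alpha>, \<beta>) \<in> sigma n \<Longrightarrow> (\<beta>, \<alpha>) \<in> sigma n"
  by (auto simp: sigma_def)

lemma same_action_sym: "same_action n \<alpha> \<beta> \<Longrightarrow> same_action n \<beta> \<alpha>"
  by (auto simp: same_action_def intro: sigma_sym)

text \<open>
  A hook of \<open>\<alpha>\<close> on \<open>x\<close> and \<open>y\<close> is detected by a diagram \<open>\<gamma>\<close> that joins 1 to \<open>x\<close> and 2 to \<open>y\<close>:
  then \<open>\<gamma>\<alpha>\<close> has a hook on 1 and 2 and so lies in \<open>I\<close>. If \<open>\<beta>\<close> lacks this hook, \<open>\<gamma>\<close> can be
  completed so that 1 is on a through line of \<open>\<gamma>\<beta>\<close>, which puts \<open>\<gamma>\<beta>\<close> into \<open>K\<close>.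
\<close>

lemma same_action_hook:
  assumes n: "odd n" "n \<ge> 3" and s: "same_action n \<alpha> \<beta>"
    and xy: "{Up x, Up y} \<in> \<alpha>"
  shows "{Up x, Up y} \<in> \<beta>"
proof (rule ccontr)
  assume not: "{Up x, Up y} \<notin> \<beta>"
  have a: "\<alpha> \<in> carrier (brauer n)" and b: "\<beta> \<in> carrier (brauer n)"
    using s by (simp_all add: same_action_def)
  have x: "x \<in> {1..n}" and y: "y \<in> {1..n}" and neq: "x \<noteq> y"
    using brauer_block_vertices[OF a xy] by simp_all
  have contra: False
    if g: "hooked n \<gamma>" and "{Up 1, Low v} \<in> \<gamma>" "{Up 2, Low w} \<in> \<gamma>" "{Up v, Up w} \<in> \<alpha>"
      and t: "{Up 1, Low t} \<in> \<gamma> \<otimes>\<^bsub>brauer n\<^esub> \<beta>" for \<gamma> v w t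
  proof -
    note g' = hooked_carrier[OF g]
    have "\<gamma> \<otimes>\<^bsub>brauer n\<^esub> \<beta> \<in> K n" by (rule hooked_K[OF n hooked_mult[OF g b] t])
    moreover have "{Up 1, Up 2} \<in> \<gamma> \<otimes>\<^bsub>brauer n\<^esub> \<alpha>" by (rule product_cap[OF g' a that(2-4)])
    then have "\<gamma> \<otimes>\<^bsub>brauer n\<^esub> \<alpha> \<notin> K n" using K_iff[OF n(1)] one_not_paired by blast
    moreover have "(\<gamma> \<otimes>\<^bsub>brauer n\<^esub> \<alpha>, \<gamma> \<otimes>\<^bsub>brauer n\<^esub> \<beta>) \<in> sigma n" using s g by (simp add: same_action_def)
    ultimately show False using sigma_K by blast
  qed
  have no_line: False if vw: "{Up v, Up w} \<in> \<alpha>" and t: "{Up v, Low t} \<in> \<beta>" for v w t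
  proof -
    have vw': "v \<in> {1..n}" "w \<in> {1..n}" "v \<noteq> w" using brauer_block_vertices[OF a vw] by simp_all
    obtain c where c: "c \<in> {1..n}" "c \<noteq> v" "c \<noteq> w" using third_point[OF n(2)] by metis
    obtain \<gamma> where g: "hooked n \<gamma>" "{Up 1, Low v} \<in> \<gamma>" "{Up 2, Low w} \<in> \<gamma>"
      using connector_exists[OF n vw'(1,2) c(1) vw'(3) _ _ perfect_matching_empty] c(2,3) by (metis empty_subsetI)
    show False by (rule contra[OF g vw product_through[OF hooked_carrier[OF g(1)] b g(2) t]])
  qed
  show False
  using b x
  proof (cases rule: brauer_up_cases)
    case (through t)
    then show False by (rule no_line[OF xy])
  next
    case xz: (upper z)
    show False
    using b y
    proof (cases rule: brauer_up_cases)
      case (through t)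
      then show False using no_line[of y x] xy by (simp add: insert_commute)
    next
      case yw: (upper w)
      \<comment> \<open>Now \<open>x\<close> and \<open>y\<close> lie on upper hooks
        \<open>x\<close>-\<open>z\<close> and \<open>y\<close>-\<open>w\<close> of \<beta>. A lower
        hook \<open>z\<close>-\<open>t\<close> of \<gamma> leads the path from 1 via
        \<open>x\<close>, \<open>z\<close>, \<open>t\<close> to \<open>s'\<close>. The line from 3
        is sent to \<open>w\<close>, a point distinct from \<open>x\<close>, \<open>y\<close>,
        \<open>z\<close> and \<open>t\<close>.\<close>
      obtain t s' where t: "{Up t, Low s'} \<in> \<beta>" using through_exists[OF n(1) b] .
      have zx: "{Up z, Up x} \<in> \<beta>" and wy: "{Up w, Up y} \<in> \<beta>" using xz yw by (simp_all add: insert_commute)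
      have z: "z \<in> {1..n}" "z \<noteq> x" and w: "w \<in> {1..n}" "w \<noteq> y" and t': "t \<in> {1..n}"
        using brauer_block_vertices[OF b xz] brauer_block_vertices[OF b yw] brauer_block_vertices[OF b t] by auto
      have "z \<noteq> y" "w \<noteq> x" using not xz wy by auto
      have "z \<noteq> w" using brauer_unique[OF b zx] wy neq by auto
      have "t \<noteq> x" "t \<noteq> y" "t \<noteq> z" "t \<noteq> w"
        using brauer_unique[OF b t] xz yw zx wy by auto
      have "perfect_matching {z, t} {{z, t}}"
        using \<open>t \<noteq> z\<close> by (auto simp: perfect_matching_def partition_on_def disjoint_def)
      moreover have sub: "{z, t} \<subseteq> {1..n} - {x, y, w}"
        using z w t' \<open>z \<noteq> y\<close> \<open>z \<noteq> w\<close> \<open>t \<noteq> x\<close> \<open>t \<noteq> y\<close> \<open>t \<noteq> w\<close> by simp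
      ultimately obtain \<gamma> where g: "hooked n \<gamma>" "{Up 1, Low x} \<in> \<gamma>" "{Up 2, Low y} \<in> \<gamma>" "{Low z, Low t} \<in> \<gamma>"
        using connector_exists[OF n x y w(1) neq not_sym[OF \<open>w \<noteq> x\<close>] not_sym[OF w(2)] _ sub]
        by (metis singletonI)
      show False by (rule contra[OF g(1-3) xy product_zigzag[OF hooked_carrier[OF g(1)] b g(2) xz g(4) t]])
    qed
  qed
qed

lemma same_action_eq:
  assumes n: "odd n" "n \<ge> 3" and s: "same_action n \<alpha> \<beta>"
  shows "\<alpha> = \<beta>"
proof -
  have a: "\<alpha> \<in> carrier (brauer n)" and b: "\<beta> \<in> carrier (brauer n)"
    using s by (simp_all add: same_action_def)
  have conn: "\<exists>\<gamma>. hooked n \<gamma> \<and> {Up 1, Low x} \<in> \<gamma>" if x: "x \<in> {1..n}" for x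
  proof -
    obtain y where y: "y \<in> {1..n}" "y \<noteq> x" using third_point[OF n(2)] by metis
    obtain z where z: "z \<in> {1..n}" "z \<noteq> x" "z \<noteq> y" using third_point[OF n(2)] by metis
    show ?thesis
      using connector_exists[OF n x y(1) z(1) _ _ _ perfect_matching_empty] y z by (metis empty_subsetI)
  qed
  have in_K: "\<gamma> \<otimes>\<^bsub>brauer n\<^esub> \<alpha> \<in> K n" "{Up 1, Low y} \<in> \<gamma> \<otimes>\<^bsub>brauer n\<^esub> \<alpha>"
    "(\<gamma> \<otimes>\<^bsub>brauer n\<^esub> \<alpha>, \<gamma> \<otimes>\<^bsub>brauer n\<^esub> \<beta>) \<in> sigma n"
    if xy: "{Up x, Low y} \<in> \<alpha>" and g: "hooked n \<gamma>" "{Up 1, Low x} \<in> \<gamma>" for x y \<gamma>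
  proof -
    show t: "{Up 1, Low y} \<in> \<gamma> \<otimes>\<^bsub>brauer n\<^esub> \<alpha>"
      by (rule product_through[OF hooked_carrier[OF g(1)] a g(2) xy])
    show "\<gamma> \<otimes>\<^bsub>brauer n\<^esub> \<alpha> \<in> K n" by (rule hooked_K[OF n hooked_mult[OF g(1) a] t])
    show "(\<gamma> \<otimes>\<^bsub>brauer n\<^esub> \<alpha>, \<gamma> \<otimes>\<^bsub>brauer n\<^esub> \<beta>) \<in> sigma n" using s g(1) by (simp add: same_action_def)
  qed
  have line: "{Up x, Low y} \<in> \<beta>" if xy: "{Up x, Low y} \<in> \<alpha>" for x y
  proof -
    have x: "x \<in> {1..n}" using brauer_block_vertices[OF a xy] by simp
    then obtain \<gamma> where g: "hooked n \<gamma>" "{Up 1, Low x} \<in> \<gamma>" using conn by blast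
    have y: "{Up 1, Low y} \<in> \<gamma> \<otimes>\<^bsub>brauer n\<^esub> \<beta>"
      using sigma_K_D(1)[OF n(1) in_K(3,1,2)[OF xy g]] .
    from b x show ?thesis
    proof (cases rule: brauer_up_cases)
      case (upper z)
      then show ?thesis
        using same_action_hook[OF n same_action_sym[OF s] upper] brauer_unique[OF a xy] by blast
    next
      case (through z)
      have "{Up 1, Low z} \<in> \<gamma> \<otimes>\<^bsub>brauer n\<^esub> \<beta>"
        by (rule product_through[OF hooked_carrier[OF g(1)] b g(2) through])
      then have "y = z" using brauer_unique[OF brauer_closed[OF hooked_carrier[OF g(1)] b] y] by blast
      then show ?thesis using through by simp
    qed
  qed
  \<comment> \<open>One \<gamma> serves all lower hooks: aimed at a line of \<alpha>, it keeps
    \<gamma>\<alpha> in \<open>K\<close>, where a class records the lower hooks.\<close>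
  obtain t s' where t: "{Up t, Low s'} \<in> \<alpha>" using through_exists[OF n(1) a] .
  have "t \<in> {1..n}" using brauer_block_vertices[OF a t] by simp
  then obtain \<gamma> where g: "hooked n \<gamma>" "{Up 1, Low t} \<in> \<gamma>" using conn by blast
  note g' = hooked_carrier[OF g(1)]
  have dom: "through_dom \<beta> \<subseteq> through_dom \<alpha>"
  proof
    fix x assume "x \<in> through_dom \<beta>"
    then obtain y where y: "{Up x, Low y} \<in> \<beta>" by (auto simp: through_dom_def)
    then have "x \<in> {1..n}" using brauer_block_vertices[OF b y] by simp
    with a show "x \<in> through_dom \<alpha>"
    proof (cases rule: brauer_up_cases)
      case (upper z)
      then show ?thesis using same_action_hook[OF n s upper] brauer_unique[OF b y] by blast
    qed (auto simp: through_dom_def)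
  qed
  show ?thesis
  proof (rule brauer_eqI[OF a b same_action_hook[OF n s] _ line])
    fix x y assume xy: "{Low x, Low y} \<in> \<alpha>"
    then have gxy: "{Low x, Low y} \<in> \<gamma> \<otimes>\<^bsub>brauer n\<^esub> \<beta>"
      using sigma_K_D(2)[OF n(1) in_K(3,1)[OF t g]] product_low_low[OF g' a] by blast
    have "x \<in> {1..n}" using brauer_block_vertices[OF a xy] by simp
    with b show "{Low x, Low y} \<in> \<beta>"
    proof (cases rule: brauer_low_cases)
      case (lower z)
      then show ?thesis
        using brauer_unique[OF brauer_closed[OF g' b] gxy product_low_low[OF g' b lower]] by simp
    next
      \<comment> \<open>By \<open>dom\<close> the point \<open>z\<close> is on a line of \<alpha> as
        well, and \<open>line\<close> forces that line to end at \<open>x\<close>, against the lower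
        hook of \<alpha> there.\<close>
      case (through z)
      then obtain w where w: "{Up z, Low w} \<in> \<alpha>" using dom by (auto simp: through_dom_def)
      then have "w = x" using line[OF w] brauer_unique[OF b through] by blast
      then have "{Low x, Up z} \<in> \<alpha>" using w by (simp add: insert_commute)
      then show ?thesis using brauer_unique[OF a xy] by blast
    qed
  qed
qed

section \<open>Representatives modulo \<open>U\<close>\<close>

definition perm_diagram :: "nat \<Rightarrow> (nat \<Rightarrow> nat) \<Rightarrow> vertex set set" where
  "perm_diagram n p = (\<lambda>x. {Up x, Low (p x)}) ` {1..n}"

lemma perm_diagram_through [simp]: "{Up x, Low y} \<in> perm_diagram n p \<longleftrightarrow> x \<in> {1..n} \<and> y = p x"
  by (simp add: perm_diagram_def image_iff doubleton_eq_iff)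

lemma perm_diagram_hooks [simp]: "{Up x, Up y} \<notin> perm_diagram n p" "{Low x, Low y} \<notin> perm_diagram n p"
  by (simp_all add: perm_diagram_def image_iff doubleton_eq_iff)

lemma involution_carrier:
  assumes "\<And>x. x \<in> {1..n} \<Longrightarrow> p x \<in> {1..n} \<and> p (p x) = x"
  shows "perm_diagram n p \<in> carrier (brauer n)"
proof -
  have inj: "p x = p y \<longleftrightarrow> x = y" if "x \<in> {1..n}" "y \<in> {1..n}" for x y
    using assms that by metis
  have "partition_on (vertices n) (perm_diagram n p)"
  proof (rule partition_onI)
    show "\<Union>(perm_diagram n p) = vertices n"
    proof (intro equalityI subsetI)
      fix v assume "v \<in> vertices n"
      then show "v \<in> \<Union>(perm_diagram n p)"
      proof (cases v)
        case (Low y)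
        with \<open>v \<in> vertices n\<close> have "y \<in> {1..n}" by simp
        then have "p y \<in> {1..n}" "Low y \<in> {Up (p y), Low (p (p y))}" using assms by auto
        then show ?thesis unfolding Low perm_diagram_def by blast
      qed (auto simp: perm_diagram_def)
    qed (use assms in \<open>auto simp: perm_diagram_def\<close>)
  qed (auto simp: perm_diagram_def disjnt_def inj)
  then show ?thesis by (auto simp: carrier_brauer perfect_matching_def perm_diagram_def)
qed

text \<open>An involution is its own inverse, so its diagram is visibly a unit; the permutations
  used below only exchange two pairs or two points.\<close>

lemma involution_U:
  assumes n: "odd n" and p: "\<And>x. x \<in> {1..n} \<Longrightarrow> p x \<in> {1..n} \<and> p (p x) = x"
    and one: "p 1 = 1" and pr: "\<And>x y. {x, y} \<in> zeta_pairs n \<Longrightarrow> {p x, p y} \<in> zeta_pairs n"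
  shows "perm_diagram n p \<in> U n"
proof -
  let ?p = "perm_diagram n p"
  have c: "?p \<in> carrier (brauer n)" by (rule involution_carrier) (rule p)
  note z = zeta_carrier[OF n]
  have d: "diagram n {} \<in> carrier (brauer n)" by (rule diagram_carrier[OF perfect_matching_empty]) simp
  have "diagram n {} = ?p \<otimes>\<^bsub>brauer n\<^esub> ?p"
  proof (rule brauer_eqI[OF d brauer_closed[OF c c]])
    fix x y assume "{Up x, Low y} \<in> diagram n {}"
    then show "{Up x, Low y} \<in> ?p \<otimes>\<^bsub>brauer n\<^esub> ?p"
      using p[of x] by (intro product_through[OF c c, of x "p x"]) auto
  qed simp_all
  then have "?p \<in> Units (brauer n)" using c by (auto simp: Units_def one_brauer)
  moreover have "zeta n = ?p \<otimes>\<^bsub>brauer n\<^esub> zeta n"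
  proof (rule brauer_eqI[OF z brauer_closed[OF c z]])
    fix x y assume xy: "{Up x, Up y} \<in> zeta n"
    then have "{Up (p x), Up (p y)} \<in> zeta n" using pr by (simp add: zeta_eq[OF n])
    then show "{Up x, Up y} \<in> ?p \<otimes>\<^bsub>brauer n\<^esub> zeta n"
      using brauer_block_vertices[OF z xy] by (intro product_cap[OF c z]) auto
  next
    fix x y assume "{Low x, Low y} \<in> zeta n"
    then show "{Low x, Low y} \<in> ?p \<otimes>\<^bsub>brauer n\<^esub> zeta n" by (rule product_low_low[OF c z])
  next
    fix x y assume xy: "{Up x, Low y} \<in> zeta n"
    then have "x \<in> {1..n} - {2..n}"
      unfolding zeta_eq[OF n] diagram_through Union_pairs[OF n] by blast
    then have x: "x = 1" "1 \<in> {1..n}" by auto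
    show "{Up x, Low y} \<in> ?p \<otimes>\<^bsub>brauer n\<^esub> zeta n"
      using xy x one by (intro product_through[OF c z _ xy]) simp
  qed
  ultimately show ?thesis by (simp add: U_def)
qed

text \<open>Exchanges the pair 2, 3 with the pair of index \<open>i\<close>, in order; it is the
  identity for \<open>i = 1\<close>.\<close>

definition swap_pairs :: "nat \<Rightarrow> nat \<Rightarrow> nat" where
  "swap_pairs i x = (if x = 2 then 2 * i else if x = 2 * i then 2
     else if x = 3 then 2 * i + 1 else if x = 2 * i + 1 then 3 else x)"

lemma swap_pairs_U:
  assumes n: "odd n" "n \<ge> 3" and i: "i \<in> {1..(n - 1) div 2}"
  shows "perm_diagram n (swap_pairs i) \<in> U n"
proof (rule involution_U[OF n(1)])
  have "2 * i + 1 \<le> n" using i n by (auto elim!: oddE)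
  then show "swap_pairs i x \<in> {1..n} \<and> swap_pairs i (swap_pairs i x) = x" if "x \<in> {1..n}" for x
    using that n i by (auto simp: swap_pairs_def)
  show "swap_pairs i 1 = 1" using i by (auto simp: swap_pairs_def)
  fix x y assume "{x, y} \<in> zeta_pairs n"
  then obtain j where j: "j \<in> {1..(n - 1) div 2}" "x = 2 * j \<and> y = 2 * j + 1 \<or> x = 2 * j + 1 \<and> y = 2 * j"
    by (auto simp: pairs_iff)
  \<comment> \<open>The index of the image pair: \<open>j\<close> under the transposition of 1 and
    \<open>i\<close>.\<close>
  define k where "k = (if j = 1 then i else if j = i then 1 else j)"
  have "swap_pairs i (2 * j) = 2 * k"
    using i by (auto simp: swap_pairs_def k_def)
  moreover have "swap_pairs i (2 * j + 1) = 2 * k + 1"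
    using i by (auto simp: swap_pairs_def k_def; presburger)
  moreover have "k \<in> {1..(n - 1) div 2}" using i j(1) by (auto simp: k_def)
  ultimately show "{swap_pairs i x, swap_pairs i y} \<in> zeta_pairs n"
    using j(2) unfolding pairs_iff by auto
qed

definition swap23 :: "nat \<Rightarrow> nat" where
  "swap23 x = (if x = 2 then 3 else if x = 3 then 2 else x)"

lemma swap23_U:
  assumes n: "odd n" "n \<ge> 3"
  shows "perm_diagram n swap23 \<in> U n"
proof (rule involution_U[OF n(1)])
  show "swap23 x \<in> {1..n} \<and> swap23 (swap23 x) = x" if "x \<in> {1..n}" for x
    using that n by (auto simp: swap23_def)
  show "swap23 1 = 1" by (simp add: swap23_def)
  fix x y assume xy: "{x, y} \<in> zeta_pairs n"
  show "{swap23 x, swap23 y} \<in> zeta_pairs n"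
  proof (cases "{x, y} = {2, 3}")
    case True
    then have "{swap23 x, swap23 y} = {2, 3}" by (auto simp: swap23_def doubleton_eq_iff)
    then show ?thesis using zeta_pairs_iff[OF n, of 2 3] by simp
  next
    case False
    then have "{x, y} \<in> eps_pairs n" using zeta_pairs_iff[OF n] xy by blast
    then have "x \<ge> 4" "y \<ge> 4" using eps_pairs_ge[OF n(1)] by auto
    then show ?thesis using xy by (simp add: swap23_def)
  qed
qed

text \<open>
  As the kernel of \<open>\<gamma>\<close> refines that of \<open>\<zeta>\<close>, rank at most 3 means that at most one of the pairs
  of \<open>\<zeta>\<close> is not a hook of \<open>\<gamma>\<close>; an element of \<open>U\<close> moves this pair to 2, 3.
\<close>

lemma hooked_representative:
  assumes n: "odd n" "n \<ge> 3" and g: "\<gamma> \<in> K n" and r: "rank \<gamma> \<le> 3"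
  obtains u where "u \<in> U n" "hooked n (u \<otimes>\<^bsub>brauer n\<^esub> \<gamma>)"
proof -
  note c = K_carrier[OF g]
  define H where "H = {1..(n - 1) div 2}"
  have le: "2 * j + 1 \<le> n" "2 * j \<in> {1..n}" "2 * j + 1 \<in> {1..n}" if "j \<in> H" for j
    using that n by (auto simp: H_def elim!: oddE)
  have dom: "2 * j \<in> through_dom \<gamma>" "2 * j + 1 \<in> through_dom \<gamma>"
    if j: "j \<in> H" and not: "{Up (2 * j), Up (2 * j + 1)} \<notin> \<gamma>" for j
  proof -
    show "2 * j \<in> through_dom \<gamma>"
      using c le(2)[OF j]
    proof (cases rule: brauer_up_cases)
      case (upper y)
      then have "{2 * j, y} \<in> zeta_pairs n" using g unfolding K_iff[OF n(1)] by blast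
      then have "y = 2 * j + 1" unfolding pairs_iff by (auto; presburger)
      then show ?thesis using upper not by simp
    qed (auto simp: through_dom_def)
    show "2 * j + 1 \<in> through_dom \<gamma>"
      using c le(3)[OF j]
    proof (cases rule: brauer_up_cases)
      case (upper y)
      then have "{2 * j + 1, y} \<in> zeta_pairs n" using g unfolding K_iff[OF n(1)] by blast
      then have "y = 2 * j" unfolding pairs_iff by (auto; presburger)
      then show ?thesis using upper not by (simp add: insert_commute)
    qed (auto simp: through_dom_def)
  qed
  have "\<exists>i\<in>H. \<forall>j\<in>H. j \<noteq> i \<longrightarrow> {Up (2 * j), Up (2 * j + 1)} \<in> \<gamma>"
  proof (rule ccontr)
    assume *: "\<not> ?thesis"
    \<comment> \<open>The negated claim, applied at index 1, gives a pair that is not a hook;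
      applied at that pair, it gives a second one. Together with 1 this puts more than three points
      on through lines.\<close>
    have "1 \<in> H" using n by (auto simp: H_def elim!: oddE)
    then obtain i where i: "i \<in> H" "{Up (2 * i), Up (2 * i + 1)} \<notin> \<gamma>" using * by blast
    then obtain j where j: "j \<in> H" "j \<noteq> i" "{Up (2 * j), Up (2 * j + 1)} \<notin> \<gamma>" using * by blast
    obtain d where "{Up 1, Low d} \<in> \<gamma>" using K_one_through[OF n(1) g] .
    then have "1 \<in> through_dom \<gamma>" by (auto simp: through_dom_def)
    then have "{1, 2 * i, 2 * i + 1, 2 * j} \<subseteq> through_dom \<gamma>"
      using dom[OF i] dom[OF j(1,3)] by blast
    then have "card {1, 2 * i, 2 * i + 1, 2 * j} \<le> card (through_dom \<gamma>)"
      by (intro card_mono finite_subset[OF through_dom_subset[OF c]]) auto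
    moreover have "2 * i + 1 \<noteq> 2 * j" "2 * i \<noteq> 1" "2 * j \<noteq> 1" by presburger+
    then have "card {1, 2 * i, 2 * i + 1, 2 * j} = 4" using i(1) j(1,2) by (auto simp: H_def)
    ultimately show False using r rank_eq_card_dom[OF c] by simp
  qed
  then obtain i where i: "i \<in> H" "\<And>j. j \<in> H \<Longrightarrow> j \<noteq> i \<Longrightarrow> {Up (2 * j), Up (2 * j + 1)} \<in> \<gamma>" by blast
  let ?u = "perm_diagram n (swap_pairs i)"
  have u: "?u \<in> U n" using swap_pairs_U[OF n] i(1) by (simp add: H_def)
  note u' = U_carrier[OF u]
  have block: "{Up (2 * j), Up (2 * j + 1)} \<in> ?u \<otimes>\<^bsub>brauer n\<^esub> \<gamma>" if j: "j \<in> {2..(n - 1) div 2}" for j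
  proof -
    have jH: "j \<in> H" "j \<noteq> 1" using j by (auto simp: H_def)
    define k where "k = (if j = i then 1 else j)"
    have "k \<noteq> i" "k \<in> H" using jH i(1) by (auto simp: k_def H_def)
    then have *: "{Up (2 * k), Up (2 * k + 1)} \<in> \<gamma>" using i(2) by blast
    have "swap_pairs i (2 * j) = 2 * k"
      using jH by (auto simp: swap_pairs_def k_def)
    moreover have "swap_pairs i (2 * j + 1) = 2 * k + 1"
      using jH by (auto simp: swap_pairs_def k_def; presburger)
    ultimately show ?thesis
      using le[OF jH(1)] by (intro product_cap[OF u' c _ _ *]) simp_all
  qed
  have "hooked n (?u \<otimes>\<^bsub>brauer n\<^esub> \<gamma>)"
    unfolding hooked_def
  proof (intro conjI allI impI brauer_closed[OF u' c])
    fix x y assume "{x, y} \<in> eps_pairs n"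
    then obtain j where "j \<in> {2..(n - 1) div 2}" "x = 2 * j \<and> y = 2 * j + 1 \<or> x = 2 * j + 1 \<and> y = 2 * j"
      unfolding pairs_iff by blast
    then show "{Up x, Up y} \<in> ?u \<otimes>\<^bsub>brauer n\<^esub> \<gamma>" using block[of j] by (auto simp: insert_commute)
  qed
  then show thesis using that u by blast
qed

text \<open>
  A hooked element of \<open>K\<close> is determined by its lower hooks and the partner of 1, except that the
  partners of 2 and 3 may be exchanged, which an element of \<open>U\<close> does.
\<close>

lemma same_class_aux:
  assumes n: "odd n" "n \<ge> 3" and g: "\<gamma> \<in> K n" "hooked n \<gamma>" and d: "\<delta> \<in> K n" "hooked n \<delta>"
    and low: "lower_hooks \<gamma> = lower_hooks \<delta>" and one: "{Up 1, Low e} \<in> \<gamma>" "{Up 1, Low e} \<in> \<delta>"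
    and two: "{Up 2, Low b} \<in> \<gamma>"
  shows "(\<gamma>, \<delta>) \<in> sigma n"
proof -
  note gc = K_carrier[OF g(1)] and dc = K_carrier[OF d(1)]
  have lowD: "{Low x, Low y} \<in> \<gamma> \<longleftrightarrow> {Low x, Low y} \<in> \<delta>" for x y
    using low lower_hooks_doubleton by metis
  have cod: "through_cod \<gamma> = through_cod \<delta>"
    using Union_lower_hooks[OF gc] Union_lower_hooks[OF dc] low
      through_cod_subset[OF gc] through_cod_subset[OF dc] by blast
  have eps: "{x, y} \<in> eps_pairs n" if xy: "{Up x, Up y} \<in> \<gamma>" for x y
  proof -
    have "{x, y} \<in> zeta_pairs n" using g(1) xy unfolding K_iff[OF n(1)] by blast
    moreover have "{Up 2, Up 3} \<notin> \<gamma>" using brauer_unique[OF gc two] by blast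
    then have "{x, y} \<noteq> {2, 3}" using xy by (metis image_empty image_insert)
    ultimately show ?thesis using zeta_pairs_iff[OF n] by blast
  qed
  then have up: "{Up x, Up y} \<in> \<delta>" if "{Up x, Up y} \<in> \<gamma>" for x y
    using hookedD[OF d(2)] that by blast
  \<comment> \<open>Inside \<open>K\<close> the only hook that 3 can carry is 2-3; since 2 is on a
    line, so is 3.\<close>
  obtain c where three: "{Up 3, Low c} \<in> \<gamma>"
  proof -
    have "3 \<in> {1..n}" using n by simp
    with gc show thesis
    proof (cases rule: brauer_up_cases)
      case (upper y)
      then have "{3, y} \<in> zeta_pairs n" using g(1) unfolding K_iff[OF n(1)] by blast
      then have "y = 2" unfolding pairs_iff by (auto; presburger)
      then have "{Up 2, Up 3} \<in> \<gamma>" using upper by (simp add: insert_commute)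
      then show thesis using brauer_unique[OF gc two] by blast
    qed (rule that)
  qed
  have ne: "b \<noteq> e" "c \<noteq> e" "b \<noteq> c"
    using brauer_unique'[OF gc, of "Up 2" "Low b" "Up 1"] brauer_unique'[OF gc, of "Up 3" "Low c" "Up 1"]
      brauer_unique'[OF gc, of "Up 2" "Low b" "Up 3"] two three one(1) by auto
  obtain x where x: "{Up x, Low b} \<in> \<delta>" using two cod by (auto simp: through_cod_def)
  obtain y where y: "{Up y, Low c} \<in> \<delta>" using three cod by (auto simp: through_cod_def)
  have x1: "x \<noteq> 1" using brauer_unique[OF dc one(2), of "Low b"] x ne by auto
  have y1: "y \<noteq> 1" using brauer_unique[OF dc one(2), of "Low c"] y ne by auto
  have xy: "x \<noteq> y" using brauer_unique[OF dc x, of "Low c"] y ne by auto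
  have gthrough: "x' = 1 \<and> y' = e \<or> x' = 2 \<and> y' = b \<or> x' = 3 \<and> y' = c"
    if "{Up x', Low y'} \<in> \<gamma>" for x' y'
    using hooked_through[OF n(1) g(2) that] one(1) two three
      brauer_unique[OF gc that, of "Low e"] brauer_unique[OF gc that, of "Low b"]
      brauer_unique[OF gc that, of "Low c"] by auto
  \<comment> \<open>The lines of \<delta> ending at \<open>b\<close> and \<open>c\<close> start in
    1, 2 or 3, and the line from 1 ends at \<open>e\<close>.\<close>
  consider "x = 2" "y = 3" | "x = 3" "y = 2"
    using hooked_through[OF n(1) d(2) x] hooked_through[OF n(1) d(2) y] x1 y1 xy by auto
  then show ?thesis
  proof cases
    case 1
    have "\<gamma> = \<delta>"
      by (rule brauer_eqI[OF gc dc up]) (use lowD gthrough one(2) x y 1 in blast)+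
    then show ?thesis using equiv_class_self[OF equiv_sigma gc] by simp
  next
    case 2
    let ?s = "perm_diagram n swap23"
    have s: "?s \<in> U n" by (rule swap23_U[OF n])
    note sc = U_carrier[OF s]
    have "\<gamma> = ?s \<otimes>\<^bsub>brauer n\<^esub> \<delta>"
    proof (rule brauer_eqI[OF gc brauer_closed[OF sc dc]])
      fix v w assume vw: "{Up v, Up w} \<in> \<gamma>"
      have "v \<in> {4..n}" "w \<in> {4..n}" using eps_pairs_ge[OF n(1) eps[OF vw]] .
      then show "{Up v, Up w} \<in> ?s \<otimes>\<^bsub>brauer n\<^esub> \<delta>"
        by (intro product_cap[OF sc dc _ _ up[OF vw]]) (auto simp: swap23_def)
    next
      fix v w assume "{Low v, Low w} \<in> \<gamma>"
      then show "{Low v, Low w} \<in> ?s \<otimes>\<^bsub>brauer n\<^esub> \<delta>" using lowD by (intro product_low_low[OF sc dc]) blast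
    next
      fix v w assume "{Up v, Low w} \<in> \<gamma>"
      then have "{Up (swap23 v), Low w} \<in> \<delta>" "v \<in> {1..n}"
        using gthrough[of v w] one(2) x y 2 n by (auto simp: swap23_def)
      then show "{Up v, Low w} \<in> ?s \<otimes>\<^bsub>brauer n\<^esub> \<delta>" by (intro product_through[OF sc dc, of v "swap23 v"]) auto
    qed
    then have "(\<delta>, \<gamma>) \<in> sigma n" using sigma_U[OF n(1) d(1) s] by simp
    then show ?thesis by (rule sigma_sym)
  qed
qed

text \<open>If 2 is on a line in either diagram, the auxiliary lemma applies, up to symmetry of
  \<open>sigma n\<close>. Otherwise both have the hook 2-3, only the line from 1 remains, and the
  diagrams are equal.\<close>

lemma same_class:
  assumes n: "odd n" "n \<ge> 3" and g: "\<gamma> \<in> K n" "hooked n \<gamma>" and d: "\<delta> \<in> K n" "hooked n \<delta>"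
    and low: "lower_hooks \<gamma> = lower_hooks \<delta>" and one: "{Up 1, Low e} \<in> \<gamma>" "{Up 1, Low e} \<in> \<delta>"
  shows "(\<gamma>, \<delta>) \<in> sigma n"
proof -
  note gc = K_carrier[OF g(1)] and dc = K_carrier[OF d(1)]
  have two: "{Up 2, Up 3} \<in> \<alpha> \<or> (\<exists>b. {Up 2, Low b} \<in> \<alpha>)" if a: "\<alpha> \<in> K n" for \<alpha>
  proof -
    have "2 \<in> {1..n}" using n by simp
    with K_carrier[OF a] show ?thesis
    proof (cases rule: brauer_up_cases)
      case (upper y)
      then have "{2, y} \<in> zeta_pairs n" using a unfolding K_iff[OF n(1)] by blast
      then have "y = 3" unfolding pairs_iff by (auto; presburger)
      then show ?thesis using upper by simp
    qed blast
  qed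
  consider b where "{Up 2, Low b} \<in> \<gamma>" | b where "{Up 2, Low b} \<in> \<delta>"
    | "{Up 2, Up 3} \<in> \<gamma>" "{Up 2, Up 3} \<in> \<delta>"
    using two[OF g(1)] two[OF d(1)] by blast
  then show ?thesis
  proof cases
    case 1
    then show ?thesis by (rule same_class_aux[OF n g d low one])
  next
    case 2
    then show ?thesis by (rule sigma_sym[OF same_class_aux[OF n d g low[symmetric] one(2,1)]])
  next
    case 3
    have "\<gamma> = \<delta>"
    proof (rule brauer_eqI[OF gc dc])
      fix x y assume "{Up x, Up y} \<in> \<gamma>"
      then have "{x, y} \<in> zeta_pairs n" using g(1) unfolding K_iff[OF n(1)] by blast
      then consider "{x, y} = {2, 3}" | "{x, y} \<in> eps_pairs n" using zeta_pairs_iff[OF n] by blast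
      then show "{Up x, Up y} \<in> \<delta>"
      proof cases
        case 1
        then show ?thesis using 3(2) by (metis image_empty image_insert)
      qed (rule hookedD[OF d(2)])
    next
      fix x y assume "{Low x, Low y} \<in> \<gamma>"
      then show "{Low x, Low y} \<in> \<delta>" using low lower_hooks_doubleton by metis
    next
      fix x y assume xy: "{Up x, Low y} \<in> \<gamma>"
      have "{Up 3, Up 2} \<in> \<gamma>" using 3(1) by (simp add: insert_commute)
      then have "x = 1"
        using hooked_through[OF n(1) g(2) xy] 3(1) brauer_unique[OF gc xy, of "Up 2"]
          brauer_unique[OF gc xy, of "Up 3"] by auto
      then show "{Up x, Low y} \<in> \<delta>" using brauer_unique[OF gc one(1), of "Low y"] xy one(2) by auto
    qed
    then show ?thesis using equiv_class_self[OF equiv_sigma gc] by simp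
  qed
qed

section \<open>Degrees\<close>

lemma quotient_class_repr: "X \<in> A // r \<Longrightarrow> \<exists>x\<in>A. X = r `` {x}"
  by (auto simp: quotient_def)

text \<open>Classes of \<open>\<tau>\<close> are fibres of the orbit map of \<open>x\<close>, so
  there are at most \<open>card X\<close> of them. A point that separates \<open>a\<close> and
  \<open>b\<close> is reached from \<open>x\<close> by some \<open>c\<close>, and then the class of
  \<open>c\<close> separates them in the quotient. \<open>gen\<close> asks that \<open>x\<close> lie
  in its own orbit, which \<open>monogenic_action\<close> alone does not give.\<close>

lemma deg_rc_le_card:
  assumes S: "monoid S" and act: "right_action S X \<mu>" and faith: "faithful_action S X \<mu>"
    and x: "x \<in> X" and gen: "X \<subseteq> {\<mu> x a | a. a \<in> carrier S}" and fin: "finite X"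
  shows "deg_rc S \<le> card X"
proof -
  interpret monoid S by (rule S)
  define \<tau> where "\<tau> = {(a, b). a \<in> carrier S \<and> b \<in> carrier S \<and> \<mu> x a = \<mu> x b}"
  have mult: "\<mu> x (a \<otimes>\<^bsub>S\<^esub> b) = \<mu> (\<mu> x a) b" if "a \<in> carrier S" "b \<in> carrier S" for a b
    using act x that by (simp add: right_action_def)
  have eq: "equiv (carrier S) \<tau>"
    by (rule equivI) (auto simp: \<tau>_def refl_on_def sym_def trans_def)
  have rc: "right_congruence S \<tau>"
    unfolding right_congruence_def using eq by (auto simp: \<tau>_def mult)
  have "faithful_action S (carrier S // \<tau>) (quot_act S \<tau>)"
    unfolding faithful_action_def
  proof (intro ballI impI)
    fix a b assume ab: "a \<in> carrier S" "b \<in> carrier S" "a \<noteq> b"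
    then obtain y where y: "y \<in> X" "\<mu> y a \<noteq> \<mu> y b" using faith by (auto simp: faithful_action_def)
    then obtain c where c: "c \<in> carrier S" "y = \<mu> x c" using gen by blast
    then have "(c \<otimes>\<^bsub>S\<^esub> a, c \<otimes>\<^bsub>S\<^esub> b) \<notin> \<tau>" using y ab by (simp add: \<tau>_def mult)
    then have "\<tau> `` {c \<otimes>\<^bsub>S\<^esub> a} \<noteq> \<tau> `` {c \<otimes>\<^bsub>S\<^esub> b}"
      using eq_equiv_class_iff[OF eq, of "c \<otimes>\<^bsub>S\<^esub> a" "c \<otimes>\<^bsub>S\<^esub> b"] c(1) ab by simp
    then have "quot_act S \<tau> (\<tau> `` {c}) a \<noteq> quot_act S \<tau> (\<tau> `` {c}) b"
      using quot_act_class[OF rc c(1)] ab by simp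
    then show "\<exists>Y\<in>carrier S // \<tau>. quot_act S \<tau> Y a \<noteq> quot_act S \<tau> Y b"
      using quotientI[OF c(1)] by blast
  qed
  then have "deg_rc S \<le> card (carrier S // \<tau>)"
    unfolding deg_rc_def using rc by (intro Least_le) blast
  also have "\<dots> \<le> card X"
  proof (rule surj_card_le[OF fin])
    show "carrier S // \<tau> \<subseteq> (\<lambda>y. {a \<in> carrier S. \<mu> x a = y}) ` X"
    proof
      fix Y assume "Y \<in> carrier S // \<tau>"
      then obtain a where a: "a \<in> carrier S" "Y = \<tau> `` {a}" using quotient_class_repr by metis
      then have "Y = {b \<in> carrier S. \<mu> x b = \<mu> x a}" by (auto simp: \<tau>_def)
      moreover have "\<mu> x a \<in> X" using act x a(1) by (simp add: right_action_def)
      ultimately show "Y \<in> (\<lambda>y. {a \<in> carrier S. \<mu> x a = y}) ` X" by blast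
    qed
  qed
  finally show ?thesis .
qed

lemma right_action_quot_act:
  assumes S: "monoid S" and rc: "right_congruence S \<tau>"
  shows "right_action S (carrier S // \<tau>) (quot_act S \<tau>)"
  unfolding right_action_def
proof (intro conjI ballI)
  interpret monoid S by (rule S)
  fix X a assume "X \<in> carrier S // \<tau>" and a: "a \<in> carrier S"
  then obtain x where x: "x \<in> carrier S" "X = \<tau> `` {x}" using quotient_class_repr by metis
  show "quot_act S \<tau> X a \<in> carrier S // \<tau>"
    unfolding x(2) quot_act_class[OF rc x(1) a] using x(1) a by (intro quotientI) simp
  fix b assume b: "b \<in> carrier S"
  show "quot_act S \<tau> (quot_act S \<tau> X a) b = quot_act S \<tau> X (a \<otimes>\<^bsub>S\<^esub> b)"
    using x(1) a b unfolding x(2) by (simp add: quot_act_class[OF rc] m_assoc)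
qed

text \<open>The action is transported along a bijection of \<open>X\<close> with
  \<open>{1..card X}\<close>. Left-to-right composition matches a right action, so the result is a
  homomorphism and not an antihomomorphism; faithfulness is its injectivity.\<close>

lemma faithful_action_embeds:
  assumes S: "monoid S" and act: "right_action S X \<mu>" and faith: "faithful_action S X \<mu>"
    and fin: "finite X"
  shows "mon S (full_transformation_monoid (card X)) \<noteq> {}"
proof -
  interpret monoid S by (rule S)
  let ?N = "{1..card X}"
  have "card ?N = card X" by simp
  then obtain h where h: "bij_betw h ?N X"
    using finite_same_card_bij[OF _ fin, of ?N] by auto
  define k where "k = the_inv_into ?N h"
  have hX: "h i \<in> X" if "i \<in> ?N" for i using h that by (auto simp: bij_betw_def)
  have kN: "k y \<in> ?N" "h (k y) = y" if "y \<in> X" for y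
    using h that f_the_inv_into_f_bij_betw[OF h] bij_betwE[OF bij_betw_the_inv_into[OF h]]
    by (auto simp: k_def)
  have \<mu>X: "\<mu> y a \<in> X" if "y \<in> X" "a \<in> carrier S" for y a
    using act that by (simp add: right_action_def)
  define \<phi> where "\<phi> a = (\<lambda>i\<in>?N. k (\<mu> (h i) a))" for a
  have \<phi>C: "\<phi> a \<in> ?N \<rightarrow>\<^sub>E ?N" if "a \<in> carrier S" for a
    unfolding \<phi>_def using kN(1)[OF \<mu>X[OF hX that]] by (intro restrict_PiE_iff[THEN iffD2] ballI)
  have "\<phi> \<in> mon S (full_transformation_monoid (card X))"
    unfolding mon_def hom_def
  proof (intro CollectI conjI ballI inj_onI)
    show "\<phi> \<in> carrier S \<rightarrow> carrier (full_transformation_monoid (card X))"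
      using \<phi>C by (simp add: full_transformation_monoid_def)
  next
    fix a b assume a: "a \<in> carrier S" and b: "b \<in> carrier S"
    have "\<mu> (h i) (a \<otimes>\<^bsub>S\<^esub> b) = \<mu> (\<mu> (h i) a) b" if "i \<in> ?N" for i
      using act hX[OF that] a b by (simp add: right_action_def)
    then have "\<phi> (a \<otimes>\<^bsub>S\<^esub> b) i = (\<lambda>i\<in>?N. \<phi> b (\<phi> a i)) i" for i
      using kN[OF \<mu>X[OF hX a]] by (simp add: \<phi>_def)
    then show "\<phi> (a \<otimes>\<^bsub>S\<^esub> b) = \<phi> a \<otimes>\<^bsub>full_transformation_monoid (card X)\<^esub> \<phi> b"
      by (simp add: full_transformation_monoid_def fun_eq_iff)
  next
    fix a b assume a: "a \<in> carrier S" and b: "b \<in> carrier S" and ab: "\<phi> a = \<phi> b"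
    have "\<mu> y a = \<mu> y b" if y: "y \<in> X" for y
    proof -
      have "\<phi> a (k y) = \<phi> b (k y)" using ab by simp
      then have "k (\<mu> y a) = k (\<mu> y b)" using kN[OF y] by (simp add: \<phi>_def)
      then show ?thesis using kN(2)[OF \<mu>X[OF y a]] kN(2)[OF \<mu>X[OF y b]] by metis
    qed
    then show "a = b" using faith a b unfolding faithful_action_def by blast
  qed
  then show ?thesis by blast
qed

text \<open>\<open>ex\<close> ensures that the minimum defining \<open>deg_rc\<close> is attained;
  the quotient action at a minimiser gives the embedding. The class of the identity supplies the
  bound \<open>m \<ge> 1\<close>.\<close>

lemma deg_le_deg_rc:
  assumes S: "monoid S" and fin: "finite (carrier S)"
    and ex: "right_congruence S \<tau>" "faithful_action S (carrier S // \<tau>) (quot_act S \<tau>)"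
  shows "deg S \<le> deg_rc S"
proof -
  interpret monoid S by (rule S)
  let ?P = "\<lambda>m. \<exists>\<tau>. right_congruence S \<tau> \<and>
     faithful_action S (carrier S // \<tau>) (quot_act S \<tau>) \<and> m = card (carrier S // \<tau>)"
  have "?P (card (carrier S // \<tau>))" using ex by blast
  then have "?P (deg_rc S)" unfolding deg_rc_def by (rule LeastI)
  then obtain \<rho> where r: "right_congruence S \<rho>" "faithful_action S (carrier S // \<rho>) (quot_act S \<rho>)"
      "deg_rc S = card (carrier S // \<rho>)" by blast
  have eq: "equiv (carrier S) \<rho>" using r(1) by (simp add: right_congruence_def)
  have finQ: "finite (carrier S // \<rho>)"
    using fin by (simp add: quotient_def)
  have "carrier S // \<rho> \<noteq> {}" using one_closed by (auto simp: quotient_def)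
  then have "deg_rc S \<ge> 1" using finQ r(3) by (simp add: Suc_le_eq card_gt_0_iff)
  moreover have "mon S (full_transformation_monoid (deg_rc S)) \<noteq> {}"
    unfolding r(3) by (rule faithful_action_embeds[OF S right_action_quot_act[OF S r(1)] r(2) finQ])
  ultimately show ?thesis unfolding deg_def by (intro Least_le) blast
qed

section \<open>The action on the classes of rank at most 3\<close>

lemma mu_class:
  assumes "odd n" "\<alpha> \<in> carrier (brauer n)" "\<beta> \<in> carrier (brauer n)"
  shows "mu n (sigma n `` {\<alpha>}) \<beta> = sigma n `` {\<alpha> \<otimes>\<^bsub>brauer n\<^esub> \<beta>}"
  unfolding mu_def by (rule quot_act_class[OF right_congruence_sigma[OF assms(1)] assms(2,3)])

lemma sigma_class_eq_iff:
  assumes "\<alpha> \<in> carrier (brauer n)" "\<beta> \<in> carrier (brauer n)"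
  shows "sigma n `` {\<alpha>} = sigma n `` {\<beta>} \<longleftrightarrow> (\<alpha>, \<beta>) \<in> sigma n"
  by (rule eq_equiv_class_iff[OF equiv_sigma assms])

lemma right_action_Omega:
  assumes "odd n"
  shows "right_action (brauer n) (Omega n) (mu n)"
  unfolding right_action_def
proof (intro conjI ballI)
  fix X \<beta> assume "X \<in> Omega n" and b: "\<beta> \<in> carrier (brauer n)"
  then obtain \<alpha> where a: "X = sigma n `` {\<alpha>}" "\<alpha> \<in> carrier (brauer n)" "rank \<alpha> \<le> 3"
    by (auto simp: Omega_def)
  show "mu n X \<beta> \<in> Omega n"
    unfolding a(1) mu_class[OF assms a(2) b] Omega_def
    using brauer_closed[OF a(2) b] order_trans[OF rank_mult_le[OF a(2) b] a(3)] by blast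
  fix \<gamma> assume c: "\<gamma> \<in> carrier (brauer n)"
  show "mu n (mu n X \<beta>) \<gamma> = mu n X (\<beta> \<otimes>\<^bsub>brauer n\<^esub> \<gamma>)"
    using a(2) b c unfolding a(1) by (simp add: mu_class[OF assms] brauer_assoc)
qed

lemma hooked_Omega:
  assumes "odd n" "hooked n \<gamma>"
  shows "sigma n `` {\<gamma>} \<in> Omega n"
  using hooked_carrier[OF assms(2)] hooked_rank[OF assms] by (auto simp: Omega_def)

lemma faithful_Omega:
  assumes n: "odd n" "n \<ge> 3"
  shows "faithful_action (brauer n) (Omega n) (mu n)"
  unfolding faithful_action_def
proof (intro ballI impI, rule ccontr)
  fix \<alpha> \<beta> assume a: "\<alpha> \<in> carrier (brauer n)" and b: "\<beta> \<in> carrier (brauer n)" and "\<alpha> \<noteq> \<beta>"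
    and *: "\<not> (\<exists>X\<in>Omega n. mu n X \<alpha> \<noteq> mu n X \<beta>)"
  have "(\<gamma> \<otimes>\<^bsub>brauer n\<^esub> \<alpha>, \<gamma> \<otimes>\<^bsub>brauer n\<^esub> \<beta>) \<in> sigma n" if g: "hooked n \<gamma>" for \<gamma>
  proof -
    note c = hooked_carrier[OF g]
    have "mu n (sigma n `` {\<gamma>}) \<alpha> = mu n (sigma n `` {\<gamma>}) \<beta>" using * hooked_Omega[OF n(1) g] by blast
    then show ?thesis
      unfolding mu_class[OF n(1) c a] mu_class[OF n(1) c b]
        sigma_class_eq_iff[OF brauer_closed[OF c a] brauer_closed[OF c b]] .
  qed
  then have "same_action n \<alpha> \<beta>" using a b by (simp add: same_action_def)
  then show False using same_action_eq[OF n] \<open>\<alpha> \<noteq> \<beta>\<close> by blast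
qed

lemma Omega_hooked_representative:
  assumes n: "odd n" "n \<ge> 3" and X: "X \<in> Omega n"
  obtains "X = I n" | \<delta> where "X = sigma n `` {\<delta>}" "hooked n \<delta>" "\<delta> \<in> K n"
proof -
  obtain \<gamma> where g: "X = sigma n `` {\<gamma>}" "\<gamma> \<in> carrier (brauer n)" "rank \<gamma> \<le> 3"
    using X by (auto simp: Omega_def)
  show thesis
  proof (cases "\<gamma> \<in> K n")
    case True
    then obtain u where u: "u \<in> U n" "hooked n (u \<otimes>\<^bsub>brauer n\<^esub> \<gamma>)"
      using hooked_representative[OF n True g(3)] by metis
    have "(\<gamma>, u \<otimes>\<^bsub>brauer n\<^esub> \<gamma>) \<in> sigma n" by (rule sigma_U[OF n(1) True u(1)])
    then have "X = sigma n `` {u \<otimes>\<^bsub>brauer n\<^esub> \<gamma>}"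
      using equiv_class_eq[OF equiv_sigma] g(1) by metis
    then show thesis using that(2) u(2) U_mult_K[OF n(1) u(1) True] by metis
  next
    case False
    then have "X = I n" using g by (auto simp: sigma_def I_def)
    then show thesis by (rule that(1))
  qed
qed

lemma I_class:
  assumes "\<gamma> \<in> I n"
  shows "sigma n `` {\<gamma>} = I n"
  using assms by (auto simp: sigma_def I_def)

lemma Omega_generated:
  assumes n: "odd n" "n \<ge> 3"
  shows "Omega n \<subseteq> {mu n (sigma n `` {eps n}) \<alpha> | \<alpha>. \<alpha> \<in> carrier (brauer n)}"
proof
  note e = eps_carrier[OF n(1)]
  fix X assume "X \<in> Omega n"
  with n show "X \<in> {mu n (sigma n `` {eps n}) \<alpha> | \<alpha>. \<alpha> \<in> carrier (brauer n)}"
  proof (cases rule: Omega_hooked_representative)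
    case 1
    \<comment> \<open>The class \<open>I\<close> is reached by imposing the hook 1-2, which is not
      one of \<zeta>, on the vertical lines of \<open>eps n\<close> at 1 and 2.\<close>
    have "perfect_matching {1, 2} {{1, 2 :: nat}}"
      by (auto simp: perfect_matching_def partition_on_def disjoint_def)
    then have a: "diagram n {{1, 2}} \<in> carrier (brauer n)" using n(2) by (intro diagram_carrier) auto
    have "1 \<in> {1..n} - {4..n}" "2 \<in> {1..n} - {4..n}" using n(2) by auto
    then have "{Up 1, Low 1} \<in> eps n" "{Up 2, Low 2} \<in> eps n"
      unfolding eps_def diagram_through Union_eps_pairs[OF n(1)] by blast+
    then have "{Up 1, Up 2} \<in> eps n \<otimes>\<^bsub>brauer n\<^esub> diagram n {{1, 2}}"
      by (rule product_cap[OF e a]) simp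
    then have "eps n \<otimes>\<^bsub>brauer n\<^esub> diagram n {{1, 2}} \<notin> K n"
      using K_iff[OF n(1)] one_not_paired by blast
    then have "eps n \<otimes>\<^bsub>brauer n\<^esub> diagram n {{1, 2}} \<in> I n"
      using brauer_closed[OF e a] by (simp add: I_def)
    then have "X = mu n (sigma n `` {eps n}) (diagram n {{1, 2}})"
      unfolding mu_class[OF n(1) e a] using 1 by (simp add: I_class)
    then show ?thesis using a by blast
  next
    case (2 \<delta>)
    then have d: "\<delta> \<in> carrier (brauer n)" by (simp add: K_def)
    have "X = mu n (sigma n `` {eps n}) \<delta>"
      unfolding mu_class[OF n(1) e d] eps_mult_hooked[OF n(1) 2(2)] by (rule 2(1))
    then show ?thesis using d by blast
  qed
qed

lemma monogenic_Omega:
  assumes n: "odd n" "n \<ge> 3"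
  shows "monogenic_action (brauer n) (Omega n) (mu n)"
proof -
  have e: "sigma n `` {eps n} \<in> Omega n" by (rule hooked_Omega[OF n(1) hooked_eps[OF n(1)]])
  moreover have "{mu n (sigma n `` {eps n}) \<alpha> | \<alpha>. \<alpha> \<in> carrier (brauer n)} \<subseteq> Omega n"
    using right_action_Omega[OF n(1)] e by (auto simp: right_action_def)
  ultimately show ?thesis
    unfolding monogenic_action_def using Omega_generated[OF n] by (intro bexI[OF _ e]) blast
qed

text \<open>
  A class other than \<open>I\<close> is determined by the projection with the lower hooks of its members and
  by the partner of 1 in them, which is one of the \<open>r\<close> through lines of that projection.
\<close>

lemma card_Omega:
  assumes n: "odd n" "n \<ge> 3"
  shows "finite (Omega n)" "card (Omega n) \<le> 1 + 3 * num_projections n 3 + num_projections n 1"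
proof -
  define Pr where "Pr r = {p \<in> projections n. rank p = r}" for r
  \<comment> \<open>The possible values of the pair of invariants. Each projection occurs as often
    as its rank, which gives the terms with coefficients 3 and 1.\<close>
  define T where "T = Sigma (Pr 3 \<union> Pr 1) through_cod"
  have carr: "p \<in> carrier (brauer n)" if "p \<in> projections n" for p
    using that by (simp add: projections_def)
  have finP: "finite (Pr r)" for r
    by (rule finite_subset[OF _ finite_brauer[of n]]) (auto simp: Pr_def carr)
  have finC: "finite (through_cod p)" if "p \<in> Pr r" for p r
    using finite_subset[OF through_cod_subset[OF carr]] that by (simp add: Pr_def)
  have finT: "finite T" unfolding T_def using finP finC by (intro finite_SigmaI) auto
  have sum_cod: "(\<Sum>p\<in>Pr r. card (through_cod p)) = r * num_projections n r" for r
  proof -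
    have "(\<Sum>p\<in>Pr r. card (through_cod p)) = (\<Sum>p\<in>Pr r. r)"
      by (rule sum.cong) (auto simp: Pr_def rank_eq_card_cod[symmetric] dest: carr)
    then show ?thesis by (simp add: num_projections_def Pr_def)
  qed
  have "card T = (\<Sum>p\<in>Pr 3 \<union> Pr 1. card (through_cod p))"
    unfolding T_def using finP finC by (intro card_SigmaI) auto
  also have "\<dots> = (\<Sum>p\<in>Pr 3. card (through_cod p)) + (\<Sum>p\<in>Pr 1. card (through_cod p))"
    using finP by (intro sum.union_disjoint) (auto simp: Pr_def)
  finally have cardT: "card T = 3 * num_projections n 3 + num_projections n 1"
    unfolding sum_cod by simp
  \<comment> \<open>Invariants are read off a hooked member of the class, because
    \<open>same_class\<close> compares only such members.\<close>
  define rep where "rep X = (SOME \<delta>. X = sigma n `` {\<delta>} \<and> hooked n \<delta> \<and> \<delta> \<in> K n)" for X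
  have rep: "X = sigma n `` {rep X}" "hooked n (rep X)" "rep X \<in> K n" if "X \<in> Omega n - {I n}" for X
  proof -
    have "\<exists>\<delta>. X = sigma n `` {\<delta>} \<and> hooked n \<delta> \<and> \<delta> \<in> K n"
      using that by (cases rule: Omega_hooked_representative[OF n, of X]) blast+
    then have "X = sigma n `` {rep X} \<and> hooked n (rep X) \<and> rep X \<in> K n"
      unfolding rep_def by (rule someI_ex)
    then show "X = sigma n `` {rep X}" "hooked n (rep X)" "rep X \<in> K n" by blast+
  qed
  define f where "f X = (diagram n (lower_hooks (rep X)), THE d. {Up 1, Low d} \<in> rep X)" for X
  have snd_f: "{Up 1, Low (snd (f X))} \<in> rep X" if X: "X \<in> Omega n - {I n}" for X
  proof -
    obtain d where d: "{Up 1, Low d} \<in> rep X" using K_one_through[OF n(1) rep(3)[OF X]] .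
    then have "\<exists>!d. {Up 1, Low d} \<in> rep X"
      using brauer_unique[OF K_carrier[OF rep(3)[OF X]] d] by blast
    then show ?thesis unfolding f_def snd_conv by (rule theI')
  qed
  have f_T: "f ` (Omega n - {I n}) \<subseteq> T"
  proof
    fix q assume "q \<in> f ` (Omega n - {I n})"
    then obtain X where X: "X \<in> Omega n - {I n}" "q = f X" by blast
    let ?p = "diagram n (lower_hooks (rep X))"
    note d = K_carrier[OF rep(3)[OF X(1)]]
    have p: "?p \<in> projections n" by (rule diagram_projection[OF lower_hooks_matching[OF d]]) blast
    have cod: "through_cod ?p = through_cod (rep X)"
      using through_cod_subset[OF d] unfolding through_cod_diagram Union_lower_hooks[OF d] by blast
    then have "rank ?p = rank (rep X)" using rank_eq_card_cod[OF d] rank_eq_card_cod[OF carr[OF p]] by simp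
    moreover have "rank (rep X) \<le> 3" "odd (rank (rep X))"
      using hooked_rank[OF n(1) rep(2)[OF X(1)]] odd_rank[OF d n(1)] by blast+
    \<comment> \<open>Parity removes ranks 0 and 2.\<close>
    then have "rank (rep X) = 3 \<or> rank (rep X) = 1" by presburger
    ultimately have "?p \<in> Pr 3 \<union> Pr 1" using p by (auto simp: Pr_def)
    moreover have "snd (f X) \<in> through_cod ?p"
      unfolding cod using snd_f[OF X(1)] by (auto simp: through_cod_def)
    ultimately show "q \<in> T" unfolding X(2) T_def by (simp add: f_def)
  qed
  have f_inj: "inj_on f (Omega n - {I n})"
  proof (rule inj_onI)
    fix X Y assume X: "X \<in> Omega n - {I n}" and Y: "Y \<in> Omega n - {I n}" and eq: "f X = f Y"
    have "diagram n (lower_hooks (rep X)) = diagram n (lower_hooks (rep Y))"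
      using arg_cong[OF eq, of fst] by (simp add: f_def)
    then have low: "{x, y} \<in> lower_hooks (rep X) \<longleftrightarrow> {x, y} \<in> lower_hooks (rep Y)" for x y
      using diagram_lower by metis
    have "lower_hooks (rep X) = lower_hooks (rep Y)"
    proof (rule perfect_matching_ext)
      show "perfect_matching ({1..n} - through_cod (rep X)) (lower_hooks (rep X))"
        "perfect_matching ({1..n} - through_cod (rep Y)) (lower_hooks (rep Y))"
        by (intro lower_hooks_matching K_carrier rep X Y)+
    qed (rule low)
    moreover have "{Up 1, Low (snd (f X))} \<in> rep X" "{Up 1, Low (snd (f X))} \<in> rep Y"
      using snd_f[OF X] snd_f[OF Y] eq by simp_all
    ultimately have "(rep X, rep Y) \<in> sigma n"
      by (intro same_class[OF n] rep X Y)
    then have "sigma n `` {rep X} = sigma n `` {rep Y}" by (rule equiv_class_eq[OF equiv_sigma])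
    then show "X = Y" using rep(1)[OF X] rep(1)[OF Y] by simp
  qed
  show fin: "finite (Omega n)" using inj_on_finite[OF f_inj f_T finT] by simp
  \<comment> \<open>The successor accounts for the class \<open>I\<close>, which \<open>f\<close>
    leaves out.\<close>
  then have "card (Omega n) \<le> Suc (card (Omega n - {I n}))"
    by (cases "I n \<in> Omega n") (simp_all add: card_Suc_Diff1)
  then show "card (Omega n) \<le> 1 + 3 * num_projections n 3 + num_projections n 1"
    using card_inj_on_le[OF f_inj f_T finT] cardT by simp
qed
theorem theorem6p16:
  fixes n :: nat
  assumes "n \<ge> 3" and "odd n"
  shows "(\<forall>\<alpha>\<in>carrier (brauer n). \<forall>\<beta>\<in>carrier (brauer n). rank \<alpha> \<le> 3 \<longrightarrow>
            mu n (sigma n `` {\<alpha>}) \<beta> = sigma n `` {\<alpha> \<otimes>\<^bsub>brauer n\<^esub> \<beta>}) \<and>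
         right_action (brauer n) (Omega n) (mu n) \<and>
         faithful_action (brauer n) (Omega n) (mu n) \<and>
         monogenic_action (brauer n) (Omega n) (mu n) \<and>
         deg (brauer n) \<le> deg_rc (brauer n) \<and>
         deg_rc (brauer n) \<le> 1 + 3 * num_projections n 3 + num_projections n 1"
proof (intro conjI ballI impI)
  note n = assms(2,1)
  note act = right_action_Omega[OF n(1)] and faith = faithful_Omega[OF n]
  show "mu n (sigma n `` {\<alpha>}) \<beta> = sigma n `` {\<alpha> \<otimes>\<^bsub>brauer n\<^esub> \<beta>}"
    if "\<alpha> \<in> carrier (brauer n)" "\<beta> \<in> carrier (brauer n)" for \<alpha> \<beta>
    by (rule mu_class[OF n(1) that])
  show "right_action (brauer n) (Omega n) (mu n)" by (rule act)
  show "faithful_action (brauer n) (Omega n) (mu n)" by (rule faith)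
  show "monogenic_action (brauer n) (Omega n) (mu n)" by (rule monogenic_Omega[OF n])
  \<comment> \<open>Members of \<open>Omega n\<close> are classes of \<open>sigma n\<close>, so
    faithfulness extends to the whole quotient. This is the witness that
    \<open>deg_le_deg_rc\<close> requires.\<close>
  have "faithful_action (brauer n) (carrier (brauer n) // sigma n) (quot_act (brauer n) (sigma n))"
    using faith unfolding faithful_action_def mu_def Omega_def by (blast intro: quotientI)
  then show "deg (brauer n) \<le> deg_rc (brauer n)"
    by (rule deg_le_deg_rc[OF monoid_brauer finite_brauer right_congruence_sigma[OF n(1)]])
  have "deg_rc (brauer n) \<le> card (Omega n)"
    by (rule deg_rc_le_card[OF monoid_brauer act faith hooked_Omega[OF n(1) hooked_eps[OF n(1)]]
          Omega_generated[OF n] card_Omega(1)[OF n]])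
  then show "deg_rc (brauer n) \<le> 1 + 3 * num_projections n 3 + num_projections n 1"
    using card_Omega(2)[OF n] by linarith
qed

end
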